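(* Let $P\subset\mathbb{H}^4$ be the hyperbolic regular right-angled $120$-cell, let $\mathcal{C}$ be the set of $24$ pairwise disjoint walls of $P$ whose normal vectors are the $8$ vectors obtained by permuting the last four coordinates of $(\sqrt{2\tau},\pm2,0,0,0)$ and the $16$ vectors $(\sqrt{2\tau},\pm1,\pm1,\pm1,\pm1)$, and let $\Gamma<G_4=\mathrm{Isom}(\mathbb{H}^4)<\mathrm{O}(1,4)$ be the discrete infinite covolume group generated by the reflections in the $96$ walls of $P$ not in $\mathcal{C}$. Then the inclusion map $\Gamma\to G_4$ is infinitesimally rigid in the representation variety $\mathrm{Hom}(\Gamma,G_4)$.
   Context: Minkowski form on $\mathbb{R}^5$: $(x,y)=-x_0y_0+\sum_{i=1}^4x_iy_i$; $\mathbb{H}^4=\{x:(x,x)=-1,x_0>0\}$; $\mathrm{O}(1,4)=\{A:A^TMA=M\}$, $M=\mathrm{diag}(-1,1,1,1,1)$; $G_4$ is the open subgroup of $\mathrm{O}(1,4)$ preserving $\mathbb{H}^4$. With $\tau=(1+\sqrt5)/2$, $P$ is the compact polytope bounded by the $120$ hyperplanes $\vec n^\perp\cap\mathbb{H}^4$ for $\vec n$ among the $24$ vectors listed above together with the $96$ vectors obtained by even permutations of the last four coordinates of $(\sqrt{2\tau},\pm\tau,\pm1,\pm\tau^{-1},0)$; its walls are dodecahedra, intersecting walls meet at right angles. The reflection in a wall with normal $\vec n$ is the element of $G_4$ fixing $\vec n^\perp$ and sending $\vec n\mapsto-\vec n$. $\Gamma$ has presentation $\langle r_1,\dots,r_{96}\mid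 r_i^2=1,\ (r_ir_j)^2=1 \text{ whenever the corresponding walls intersect}\rangle$. Given this presentation, $\mathrm{Hom}(\Gamma,\mathrm{O}(1,4))$ is the zero set in $V=\mathbb{R}^{25\cdot 96}$ (tuples of matrices $\rho(r_j)$) of the polynomial equations $P_\alpha$ expressing $\rho(r_j)^TM\rho(r_j)=M$ and each relation; $\mathrm{Hom}(\Gamma,G_4)$ is the union of components where each $\rho(r_j)$ has positive upper-left entry. $G_4$ acts by conjugation. An infinitesimal deformation of $\rho$ is a tangent vector $p'(0)\in T_\rho V$ of a smooth path $p:(-\varepsilon,\varepsilon)\to V$ with $p(0)=\rho$ and $\frac{d}{dt}|_0P_\alpha(p(t))=0$ for all $\alpha$; an infinitesimal conjugation is a tangent vector at $\rho$ to a smooth path in the orbit $G_4\cdot\rho$; $\rho$ is infinitesimally rigid if every infinitesimal deformation is an infinitesimal conjugation. *)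

theory Defs
  imports "HOL-Analysis.Analysis" "HOL-Combinatorics.Permutations"
begin

definition mink :: "real^5 \<Rightarrow> real^5 \<Rightarrow> real" where
  "mink x y = - (x$0 * y$0) + x$1 * y$1 + x$2 * y$2 + x$3 * y$3 + x$4 * y$4"

definition Mmat :: "real^5^5" where
  "Mmat = (\<chi> i j. if i = j then (if i = 0 then -1 else 1) else 0)"

definition H4 :: "(real^5) set" where
  "H4 = {x. mink x x = -1 \<and> x$0 > 0}"

definition O14 :: "(real^5^5) set" where
  "O14 = {A. transpose A ** Mmat ** A = Mmat}"

definition G4 :: "(real^5^5) set" where
  "G4 = {A \<in> O14. \<forall>x\<in>H4. A *v x \<in> H4}"

definition tau :: real where "tau = (1 + sqrt 5) / 2"

definition vec5 :: "(nat \<Rightarrow> real) \<Rightarrow> real^5" where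
  "vec5 f = (\<chi> i::5. if i = 0 then f 0 else if i = 1 then f 1 else if i = 2 then f 2
                      else if i = 3 then f 3 else f 4)"

definition normalsC :: "(real^5) set" where
  "normalsC =
     {vec5 (\<lambda>k. if k = 0 then sqrt (2*tau) else if k = m then s * 2 else 0) | m s.
        m \<in> {1..4} \<and> s \<in> {-1, 1}}
   \<union> {vec5 (\<lambda>k. if k = 0 then sqrt (2*tau) else s k) | s.
        \<forall>k\<in>{1..4}. s k \<in> {-1, 1}}"

definition normals96 :: "(real^5) set" where
  "normals96 =
     {vec5 (\<lambda>k. if k = 0 then sqrt (2*tau)
                else (\<lambda>j. if j = 1 then s1 * tau else if j = 2 then s2
                          else if j = 3 then s3 / tau else 0) (\<sigma> k)) | \<sigma> s1 s2 s3.
        \<sigma> permutes {1..4} \<and> evenperm \<sigma> \<and> s1 \<in> {-1, 1} \<and> s2 \<in> {-1, 1} \<and> s3 \<in> {-1, 1}}"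

definition normals120 :: "(real^5) set" where
  "normals120 = normalsC \<union> normals96"

text \<open>The polytope P: the side of each hyperplane containing (1,0,0,0,0).\<close>
definition P120 :: "(real^5) set" where
  "P120 = {x \<in> H4. \<forall>n\<in>normals120. mink x n \<le> 0}"

definition wall :: "real^5 \<Rightarrow> (real^5) set" where
  "wall n = {x \<in> P120. mink x n = 0}"

definition walls_intersect :: "real^5 \<Rightarrow> real^5 \<Rightarrow> bool" where
  "walls_intersect n m \<longleftrightarrow> wall n \<inter> wall m \<noteq> {}"

definition refl_mat :: "real^5 \<Rightarrow> real^5^5" where
  "refl_mat n = (THE A. A \<in> G4 \<and> (\<forall>x. mink x n = 0 \<longrightarrow> A *v x = x) \<and> A *v n = - n)"

text \<open>Tuples in V are indexed by the 96 generators, i.e. by their normals.\<close>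
type_synonym tuple = "real^5 \<Rightarrow> real^5^5"

definition smooth_on :: "real set \<Rightarrow> (real \<Rightarrow> 'a::real_normed_vector) \<Rightarrow> bool" where
  "smooth_on S f \<longleftrightarrow> (\<exists>D. (\<forall>t\<in>S. D 0 t = f t) \<and>
      (\<forall>k. \<forall>t\<in>S. (D k has_vector_derivative D (Suc k) t) (at t)))"

definition smooth_path :: "real \<Rightarrow> (real \<Rightarrow> tuple) \<Rightarrow> bool" where
  "smooth_path e p \<longleftrightarrow> (\<forall>n\<in>normals96. smooth_on {-e<..<e} (\<lambda>t. p t n))"

text \<open>The polynomial equations P_alpha, grouped into matrix-valued equations.\<close>
definition inf_deformation :: "tuple \<Rightarrow> tuple \<Rightarrow> bool" where
  "inf_deformation \<rho> v \<longleftrightarrow> (\<exists>e>0. \<exists>p. smooth_path e p \<and>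
      (\<forall>n\<in>normals96. p 0 n = \<rho> n \<and> ((\<lambda>t. p t n) has_vector_derivative v n) (at 0)) \<and>
      (\<forall>n\<in>normals96. ((\<lambda>t. transpose (p t n) ** Mmat ** p t n - Mmat)
                           has_vector_derivative 0) (at 0)) \<and>
      (\<forall>n\<in>normals96. ((\<lambda>t. p t n ** p t n - mat 1) has_vector_derivative 0) (at 0)) \<and>
      (\<forall>n\<in>normals96. \<forall>m\<in>normals96. n \<noteq> m \<and> walls_intersect n m \<longrightarrow>
          ((\<lambda>t. (p t n ** p t m) ** (p t n ** p t m) - mat 1) has_vector_derivative 0) (at 0)))"

definition inf_conjugation :: "tuple \<Rightarrow> tuple \<Rightarrow> bool" where
  "inf_conjugation \<rho> v \<longleftrightarrow> (\<exists>e>0. \<exists>p. smooth_path e p \<and>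
      (\<forall>n\<in>normals96. p 0 n = \<rho> n \<and> ((\<lambda>t. p t n) has_vector_derivative v n) (at 0)) \<and>
      (\<forall>t\<in>{-e<..<e}. \<exists>g\<in>G4. \<forall>n\<in>normals96. p t n = g ** \<rho> n ** matrix_inv g))"

definition inf_rigid :: "tuple \<Rightarrow> bool" where
  "inf_rigid \<rho> \<longleftrightarrow> (\<forall>v. inf_deformation \<rho> v \<longrightarrow> inf_conjugation \<rho> v)"

end

theory Submission
  imports Defs
begin

text \<open>
  Write the normals as \<open>n = (s, x)\<close> with \<open>s\<^sup>2 = 2\<tau>\<close>. Differentiating the relations \<open>r_n\<^sup>2 = 1\<close> and
  \<open>r_n \<in> O(1,4)\<close>, an infinitesimal deformation moves each normal by some \<open>w_n\<close> orthogonal to \<open>n\<close>, and the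
  commutation relations say \<open>(w_n, m) + (n, w_m) = 0\<close> for intersecting walls. In terms of the spatial
  parts \<open>u_x\<close> of \<open>w_n\<close> this reads \<open>(u_x - u_y) \<bullet> (x - y) = 0\<close> for \<open>x \<bullet> y = 2\<tau>\<close>: an infinitesimal motion
  of the bar framework in \<open>R\<^sup>4\<close> formed by the edges of the snub 24-cell (the 600-cell with 24
  vertices removed). Explicit self-stresses show that the squared distance is also preserved to
  first order for all pairs with \<open>x \<bullet> y = 2\<close>, first for the diagonals of the 24 icosahedral cells, then for the
  remaining pairs. After subtracting an infinitesimal isometry that agrees with the motion on four vertices, a
  chain of vertices, each joined to four earlier ones in independent directions, shows that the
  motion vanishes. The infinitesimal isometry is an element \<open>X\<close> of the Lie algebra
  of \<open>O(1,4)\<close>, and conjugation by \<open>exp (t X)\<close> realises the deformation.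
\<close>

section \<open>The snub 24-cell over the golden integers\<close>

text \<open>The pair \<^term>\<open>(a, b)\<close> stands for \<open>a + b\<tau>\<close>.\<close>

type_synonym golden = "int \<times> int"
type_synonym 'a quad = "'a \<times> 'a \<times> 'a \<times> 'a"

fun gmul :: "golden \<Rightarrow> golden \<Rightarrow> golden" where
  "gmul (a, b) (c, d) = (a * c + b * d, a * d + b * c + b * d)"

text \<open>The field norm of a + b tau: its product with the Galois conjugate (a + b) - b
  tau.\<close>

fun gnorm :: "golden \<Rightarrow> int" where
  "gnorm (a, b) = a * a + a * b - b * b"

fun gdot :: "golden quad \<Rightarrow> golden quad \<Rightarrow> golden" where
  "gdot (a, b, c, d) (a', b', c', d') = gmul a a' + gmul b b' + gmul c c' + gmul d d'"

fun gscale :: "golden \<Rightarrow> golden quad \<Rightarrow> golden quad" where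
  "gscale r (a, b, c, d) = (gmul r a, gmul r b, gmul r c, gmul r d)"

text \<open>The 4 x 4 determinant by Laplace expansion along the first two rows, in products of
  complementary 2 x 2 minors.\<close>

fun gdet :: "golden quad \<Rightarrow> golden quad \<Rightarrow> golden quad \<Rightarrow> golden quad \<Rightarrow> golden" where
  "gdet (a0, a1, a2, a3) (b0, b1, b2, b3) (c0, c1, c2, c3) (d0, d1, d2, d3) =
    (let p01 = gmul a0 b1 - gmul a1 b0; p02 = gmul a0 b2 - gmul a2 b0;
         p03 = gmul a0 b3 - gmul a3 b0; p12 = gmul a1 b2 - gmul a2 b1;
         p13 = gmul a1 b3 - gmul a3 b1; p23 = gmul a2 b3 - gmul a3 b2;
         q01 = gmul c0 d1 - gmul c1 d0; q02 = gmul c0 d2 - gmul c2 d0;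
         q03 = gmul c0 d3 - gmul c3 d0; q12 = gmul c1 d2 - gmul c2 d1;
         q13 = gmul c1 d3 - gmul c3 d1; q23 = gmul c2 d3 - gmul c3 d2
     in gmul p01 q23 - gmul p02 q13 + gmul p03 q12 + gmul p12 q03 - gmul p13 q02 + gmul p23 q01)"

section \<open>Symmetries, vertices and edges\<close>

fun flip :: "('a::uminus) quad \<Rightarrow> 'a quad" where
  "flip (a, b, c, d) = (- a, b, c, d)"

fun cycle :: "'a quad \<Rightarrow> 'a quad" where
  "cycle (a, b, c, d) = (b, c, a, d)"

fun dbl_swap :: "'a quad \<Rightarrow> 'a quad" where
  "dbl_swap (a, b, c, d) = (b, a, d, c)"

fun even_perms :: "'a quad \<Rightarrow> 'a quad list" where
  "even_perms (a, b, c, d) =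
    [(a, b, c, d), (b, c, a, d), (c, a, b, d), (b, a, d, c), (a, d, b, c), (d, b, a, c),
     (c, d, a, b), (d, a, c, b), (a, c, d, b), (d, c, b, a), (c, b, d, a), (b, d, c, a)]"

definition base :: "golden quad" where
  "base = ((0, 1), (1, 0), (-1, 1), (0, 0))"

definition V96 :: "golden quad list" where
  "V96 = concat (map even_perms
    [(r, s, t, (0, 0)). r \<leftarrow> [(0, 1), (0, -1)], s \<leftarrow> [(1, 0), (-1, 0)], t \<leftarrow> [(-1, 1), (1, -1)]])"

text \<open>Spatial parts of the removed normals; the vertices of \<open>V96\<close> adjacent to one
  of them form an icosahedral cell.\<close>

definition C24 :: "golden quad list" where
  "C24 = concat [[(x, 0, 0, 0), (0, x, 0, 0), (0, 0, x, 0), (0, 0, 0, x)]. x \<leftarrow> [(2, 0), (-2, 0)]] @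
    [(r, s, t, v). r \<leftarrow> [(1, 0), (-1, 0)], s \<leftarrow> [(1, 0), (-1, 0)],
                   t \<leftarrow> [(1, 0), (-1, 0)], v \<leftarrow> [(1, 0), (-1, 0)]]"

text \<open>As all normals have time coordinate \<open>sqrt (2 * tau)\<close>, the product 2 tau
  says that two normals are Minkowski-orthogonal.\<close>

definition adjacent :: "golden quad \<Rightarrow> golden quad \<Rightarrow> bool" where
  "adjacent x y \<longleftrightarrow> gdot x y = (0, 2)"

definition diagonal :: "golden quad \<Rightarrow> golden quad \<Rightarrow> bool" where
  "diagonal x y \<longleftrightarrow> gdot x y = (2, 0) \<and> (\<exists>c\<in>set C24. adjacent c x \<and> adjacent c y)"

section \<open>Self-stresses\<close>

definition balanced :: "(golden quad \<Rightarrow> golden quad \<Rightarrow> golden) \<Rightarrow> golden quad list \<Rightarrow> bool" where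
  "balanced w L \<longleftrightarrow> (\<forall>x\<in>set L. (\<Sum>y\<leftarrow>L. gscale (w x y) (y - x)) = 0)"

text \<open>Conditionals replace disjunctions here and below because evaluation by rewriting
  would compute both sides of a disjunction.\<close>

definition supported :: "(golden quad \<Rightarrow> golden quad \<Rightarrow> bool) \<Rightarrow>
    (golden quad \<Rightarrow> golden quad \<Rightarrow> golden) \<Rightarrow> golden quad list \<Rightarrow> golden quad \<Rightarrow> golden quad \<Rightarrow> bool" where
  "supported B w L p q \<longleftrightarrow> (\<forall>x\<in>set L. \<forall>y\<in>set L. w y x = w x y \<and>
     (if w x y = 0 then True else if x = p \<and> y = q then True
      else if x = q \<and> y = p then True else B x y))"

definition is_stress :: "(golden quad \<Rightarrow> golden quad \<Rightarrow> bool) \<Rightarrow>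
    (golden quad \<Rightarrow> golden quad \<Rightarrow> golden) \<Rightarrow> golden quad list \<Rightarrow> golden quad \<Rightarrow> golden quad \<Rightarrow> bool" where
  "is_stress B w L p q \<longleftrightarrow> balanced w L \<and> supported B w L p q \<and>
     p \<in> set L \<and> q \<in> set L \<and> gnorm (w p q) \<noteq> 0"

text \<open>Weights depend on unordered pairs of orbits, so each pair is tabulated once; absent
  pairs carry no stress.\<close>

definition lookup :: "(('k \<times> 'k) \<times> golden) list \<Rightarrow> 'k \<Rightarrow> 'k \<Rightarrow> golden" where
  "lookup tab a b = (case map_of tab (a, b) of Some r \<Rightarrow> r
     | None \<Rightarrow> (case map_of tab (b, a) of Some r \<Rightarrow> r | None \<Rightarrow> 0))"

text \<open>A self-stress of an icosahedral cell with one diagonal \<open>pq\<close> added. The weights are constant on the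
  orbits of the stabiliser of \<open>{p, q}\<close>, which are told apart by the products with \<open>p + q\<close>.\<close>

definition ico_stress :: "golden quad \<Rightarrow> golden quad \<Rightarrow> golden quad \<Rightarrow> golden quad \<Rightarrow> golden" where
  "ico_stress p q x y =
    (if adjacent x y \<or> x = p \<and> y = q \<or> x = q \<and> y = p then
       lookup [(((-2, 4), (2, 2)), (2, 1)), (((-2, 4), (4, 0)), (-3, 1)), (((-2, 4), (6, 0)), (2, -4)),
         (((0, 4), (0, 4)), (12, 6)), (((0, 4), (2, 2)), (-3, 6)), (((0, 4), (6, 0)), (-3, -9)),
         (((2, 2), (2, 2)), (2, -4)), (((2, 2), (4, 0)), (7, -4)), (((2, 2), (6, 0)), (-8, 1)),
         (((4, 0), (4, 0)), (-8, 6)), (((6, 0), (6, 0)), (20, 0))]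
         (gdot x (p + q)) (gdot y (p + q))
     else 0)"

text \<open>The stress for the pairs with \<open>p \<bullet> q = 2\<close> that are not in a common icosahedral cell: it uses the
  three common neighbours of \<open>p\<close> and \<open>q\<close> and six vertices with product 2 with both.\<close>

definition bipyramid_stress :: "golden quad \<Rightarrow> golden quad \<Rightarrow> golden quad \<Rightarrow> golden quad \<Rightarrow> golden" where
  "bipyramid_stress p q x y =
    (if adjacent x y then
       lookup [(((0, 4), (0, 4)), (0, 1)), (((4, 0), (4, 0)), (2, -1)), (((6, 0), (0, 4)), (0, -2))]
         (gdot x (p + q)) (gdot y (p + q))
     else if gdot x y = (2, 0) then
       lookup [(((6, 0), (6, 0)), (6, 0)), (((0, 4), (4, 0)), (-1, 1)), (((6, 0), (4, 0)), (-2, 1))]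
         (gdot x (p + q)) (gdot y (p + q))
     else 0)"

section \<open>Finite checks over the golden integers\<close>

lemma distinct_V96: "distinct V96"
  by code_simp

text \<open>The three maps generate the even permutations with all sign changes. \<open>V96\<close>
  is a single orbit (\<open>V96_induct\<close>), so the stress checks below treat only pairs that
  start at \<open>base\<close>.\<close>

lemma V96_closed:
  "\<forall>p\<in>set V96. flip p \<in> set V96 \<and> cycle p \<in> set V96 \<and> dbl_swap p \<in> set V96"
  by code_simp

lemma C24_closed:
  "\<forall>p\<in>set C24. flip p \<in> set C24 \<and> cycle p \<in> set C24 \<and> dbl_swap p \<in> set C24"
  by code_simp

text \<open>\<open>c\<close> runs over the removed vertices whose icosahedral cells contain
  \<open>base\<close>, and \<open>q\<close> over the vertices of such a cell that form a diagonal
  with \<open>base\<close>.\<close>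

lemma ico_stress_base:
  "\<forall>c\<in>set (filter (\<lambda>c. adjacent c base) C24).
    \<forall>q\<in>set (filter (\<lambda>q. gdot base q = (2, 0) \<and> adjacent c q) V96).
      is_stress adjacent (ico_stress base q) (filter (adjacent c) V96) base q"
  by code_simp

text \<open>The bars now include icosahedral diagonals. The filter keeps \<open>base\<close> and
  \<open>q\<close> (value 6), their common neighbours (4 tau) and the vertices with product 2 with
  both (4).\<close>

lemma bipyramid_stress_base:
  "\<forall>q\<in>set (filter (\<lambda>q. gdot base q = (2, 0) \<and> \<not> diagonal base q) V96).
    is_stress (\<lambda>x y. if adjacent x y then True else diagonal x y) (bipyramid_stress base q)
      (filter (\<lambda>x. gdot x (base + q) \<in> {(6, 0), (0, 4), (4, 0)}) V96) base q"
  by code_simp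

text \<open>The largest value listed is 2 tau, so every other normal has Minkowski product at most 0
  with that of \<open>base\<close>.\<close>

lemma gdot_base:
  "\<forall>k\<in>set (V96 @ C24). k = base \<or> gdot k base \<in>
     {(0, 2), (2, 0), (-2, 2), (0, 0), (2, -2), (-2, 0), (0, -2), (-4, 0)}"
  by code_simp

section \<open>Pinning chain\<close>

definition pinned :: "golden quad \<Rightarrow> golden quad \<Rightarrow> golden quad \<Rightarrow> golden quad \<Rightarrow> golden quad \<Rightarrow> bool" where
  "pinned x p q r s \<longleftrightarrow> (\<forall>y\<in>{p, q, r, s}. gdot x y \<in> {(0, 2), (2, 0)}) \<and>
     gnorm (gdet (x - p) (x - q) (x - r) (x - s)) \<noteq> 0"

text \<open>\<open>K\<close> holds the indices of the vertices already known to be at rest; when the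
  chain ends it must cover all of them.\<close>

fun spreads :: "nat list \<Rightarrow> (nat \<times> nat quad) list \<Rightarrow> bool" where
  "spreads K [] \<longleftrightarrow> (\<forall>i<96. i \<in> set K)"
| "spreads K ((i, a, b, c, d) # cs) \<longleftrightarrow> i < 96 \<and> (\<forall>j\<in>{a, b, c, d}. j < 96 \<and> j \<in> set K) \<and>
     pinned (V96 ! i) (V96 ! a) (V96 ! b) (V96 ! c) (V96 ! d) \<and> spreads (i # K) cs"

text \<open>Found by greedy search: each entry lists a vertex and four vertices pinning it, all of them
  initial or occurring earlier.\<close>

definition spreading :: "(nat \<times> nat quad) list" where
  "spreading = [
    (10,0,12,8,20), (3,0,12,8,10), (2,0,12,8,3), (4,0,12,8,10), (26,0,12,8,3), (27,10,3,2,26),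
    (11,0,8,20,10), (34,8,20,4,11), (28,0,12,8,10), (51,20,4,11,28), (24,0,8,4,11), (1,0,8,3,24),
    (5,0,10,3,27), (25,2,27,1,5), (14,3,2,1,5), (22,10,3,11,5), (7,0,8,3,26), (74,20,34,28,24),
    (50,20,4,34,74), (75,34,51,74,50), (52,27,5,25,75), (76,27,22,75,52), (48,27,5,14,76), (56,27,25,22,76),
    (72,25,75,52,76), (62,51,50,52,72), (53,12,10,3,27), (73,26,27,76,53), (49,12,8,3,73), (55,20,11,34,74),
    (38,3,26,14,22), (32,0,12,8,3), (82,24,74,50,32), (58,0,12,2,82), (70,14,48,38,58), (59,0,24,1,82),
    (46,11,34,51,22), (35,10,27,11,34), (6,0,8,20,10), (23,12,8,20,10), (13,0,20,4,11), (9,8,10,3,27),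
    (29,4,11,34,1), (31,0,3,2,27), (86,51,74,76,72), (80,27,25,14,76), (94,72,62,82,70), (83,25,48,72,82),
    (60,27,14,22,52), (68,22,75,52,76), (54,12,8,20,10), (71,12,49,82,58), (61,12,20,28,53), (57,2,1,25,32),
    (77,34,28,51,75), (79,51,24,74,75), (36,12,8,4,34), (44,0,12,20,51), (30,0,2,4,24), (47,10,27,34,22),
    (37,5,25,50,75), (33,8,10,3,27), (15,0,12,8,3), (18,11,1,5,25), (21,20,10,4,11), (17,0,2,1,5),
    (84,75,52,76,62), (92,75,52,76,48), (78,12,26,28,74), (95,73,82,58,70), (85,74,75,76,73), (81,26,73,49,32),
    (63,20,51,24,50), (66,22,76,53,49), (69,50,62,82,58), (65,12,26,53,73), (39,2,26,27,25), (42,1,5,14,52),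
    (45,20,10,11,51), (41,24,1,25,50), (16,0,12,8,2), (19,12,8,3,2), (87,74,50,75,72), (90,76,53,73,38),
    (93,74,82,58,70), (89,74,73,49,82), (64,25,14,52,48), (67,20,34,51,50), (40,0,12,8,26), (43,12,3,2,27),
    (88,76,48,72,73), (91,51,74,75,82)]"

lemma spreads_spreading: "spreads [0, 8, 12, 20] spreading"
  by code_simp

section \<open>Real values of golden integers\<close>

lemma tau_square: "tau * tau = tau + 1"
  by (simp add: tau_def field_simps)

lemma tau_bounds: "1 < tau" "tau < 2"
proof -
  have "1 < sqrt 5" "sqrt 5 < 3" by (simp_all add: real_less_lsqrt)
  then show "1 < tau" "tau < 2" by (simp_all add: tau_def)
qed

lemma inverse_tau: "1 / tau = tau - 1"
  using tau_square tau_bounds by (simp add: field_simps)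

definition gval :: "golden \<Rightarrow> real" where
  "gval r = of_int (fst r) + of_int (snd r) * tau"

lemma gval_simps [simp]:
  "gval (a, b) = of_int a + of_int b * tau"
  "gval 0 = 0"
  "gval (r + s) = gval r + gval s"
  "gval (r - s) = gval r - gval s"
  "gval (- r) = - gval r"
  by (simp_all add: gval_def algebra_simps)

lemma gval_gmul [simp]: "gval (gmul r s) = gval r * gval s"
proof -
  obtain a b c d where [simp]: "r = (a, b)" "s = (c, d)" by (metis surj_pair)
  have "gval r * gval s = a * c + (a * d + b * c) * tau + b * d * (tau * tau)"
    by (simp add: algebra_simps)
  then show ?thesis by (simp add: tau_square algebra_simps)
qed

text \<open>Multiplication by the Galois conjugate (a + b) - b tau turns the value into the integer
  norm.\<close>

lemma gval_nonzero:
  assumes "gnorm r \<noteq> 0"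
  shows "gval r \<noteq> 0"
proof
  obtain a b where [simp]: "r = (a, b)" by (metis surj_pair)
  assume "gval r = 0"
  then have "gval (gmul r (a + b, - b)) = 0" by (simp only: gval_gmul mult_zero_left)
  moreover have "gmul r (a + b, - b) = (gnorm r, 0)" by (simp add: algebra_simps)
  ultimately have "gval (gnorm r, 0) = 0" by metis
  then have "real_of_int (gnorm r) = 0"
    by (simp only: gval_simps of_int_0 mult_zero_left add_0_right)
  then show False using assms by (simp only: of_int_eq_0_iff)
qed

fun qval :: "golden quad \<Rightarrow> real quad" where
  "qval (a, b, c, d) = (gval a, gval b, gval c, gval d)"

lemma qval_simps [simp]:
  "qval 0 = 0"
  "qval (x + y) = qval x + qval y"
  "qval (x - y) = qval x - qval y"
  "qval (gscale r x) = gval r *\<^sub>R qval x"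
  by (cases x rule: prod_cases4; cases y rule: prod_cases4; simp add: zero_prod_def)+

lemma qval_sum_list: "qval (sum_list xs) = sum_list (map qval xs)"
  by (induction xs) simp_all

lemma gval_gdot: "gval (gdot x y) = qval x \<bullet> qval y"
  by (cases x rule: prod_cases4; cases y rule: prod_cases4) simp

lemma qval_flip: "qval (flip x) = flip (qval x)"
  and qval_cycle: "qval (cycle x) = cycle (qval x)"
  and qval_dbl_swap: "qval (dbl_swap x) = dbl_swap (qval x)"
  by (cases x rule: prod_cases4; simp)+

lemma inner_flip [simp]: "flip a \<bullet> flip b = a \<bullet> (b :: real quad)"
  and inner_cycle [simp]: "cycle a \<bullet> cycle b = a \<bullet> (b :: real quad)"
  and inner_dbl_swap [simp]: "dbl_swap a \<bullet> dbl_swap b = a \<bullet> (b :: real quad)"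
  by (cases a rule: prod_cases4; cases b rule: prod_cases4; simp)+

lemma gdot_flip [simp]: "gdot (flip x) (flip y) = gdot x y"
  and gdot_cycle [simp]: "gdot (cycle x) (cycle y) = gdot x y"
  and gdot_dbl_swap [simp]: "gdot (dbl_swap x) (dbl_swap y) = gdot x y"
proof -
  have "gmul (- a) (- b) = gmul a b" for a b by (cases a; cases b) simp
  then show "gdot (flip x) (flip y) = gdot x y" by (cases x rule: prod_cases4; cases y rule: prod_cases4) simp
qed (cases x rule: prod_cases4; cases y rule: prod_cases4; simp add: ac_simps)+

lemma flip_flip [simp]: "flip (flip x) = (x :: ('a::ab_group_add) quad)"
  and cycle_cycle_cycle [simp]: "cycle (cycle (cycle y)) = y"
  and dbl_swap_dbl_swap [simp]: "dbl_swap (dbl_swap y) = y"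
  by (cases x rule: prod_cases4; cases y rule: prod_cases4; simp)+

section \<open>Rigidity of the framework\<close>

lemma V96_flip: "x \<in> set V96 \<Longrightarrow> flip x \<in> set V96"
  and V96_cycle: "x \<in> set V96 \<Longrightarrow> cycle x \<in> set V96"
  and V96_dbl_swap: "x \<in> set V96 \<Longrightarrow> dbl_swap x \<in> set V96"
  using V96_closed by auto

lemma C24_flip: "x \<in> set C24 \<Longrightarrow> flip x \<in> set C24"
  and C24_cycle: "x \<in> set C24 \<Longrightarrow> cycle x \<in> set C24"
  and C24_dbl_swap: "x \<in> set C24 \<Longrightarrow> dbl_swap x \<in> set C24"
  using C24_closed by auto

lemma base_in_V96: "base \<in> set V96"
  by (simp add: base_def V96_def)

text \<open>The orbit of \<open>base\<close> is all of \<open>V96\<close>: conjugating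
  \<open>flip\<close> by powers of \<open>cycle\<close> changes the second and third signs, and
  \<open>cycle\<close> and \<open>dbl_swap\<close> generate the even permutations.\<close>

lemma V96_induct [consumes 1, case_names base flip cycle dbl_swap]:
  assumes "x \<in> set V96" and "P base"
    and "\<And>x. x \<in> set V96 \<Longrightarrow> P x \<Longrightarrow> P (flip x)"
    and "\<And>x. x \<in> set V96 \<Longrightarrow> P x \<Longrightarrow> P (cycle x)"
    and "\<And>x. x \<in> set V96 \<Longrightarrow> P x \<Longrightarrow> P (dbl_swap x)"
  shows "P x"
proof -
  define Q where "Q x \<longleftrightarrow> x \<in> set V96 \<and> P x" for x
  have base: "Q base" using assms(2) base_in_V96 by (simp add: Q_def)
  have Q: "Q (flip x)" "Q (cycle x)" "Q (dbl_swap x)" if "Q x" for x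
    using that assms(3-5) by (auto simp: Q_def V96_flip V96_cycle V96_dbl_swap)
  have neg1: "Q (- a, b, c, d)" if "Q (a, b, c, d)" for a b c d
    using Q(1)[OF that] by simp
  have cyc: "Q (b, c, a, d)" if "Q (a, b, c, d)" for a b c d
    using Q(2)[OF that] by simp
  have swp: "Q (b, a, d, c)" if "Q (a, b, c, d)" for a b c d
    using Q(3)[OF that] by simp
  have neg2: "Q (a, - b, c, d)" if "Q (a, b, c, d)" for a b c d
    using cyc[OF cyc[OF neg1[OF cyc[OF that]]]] .
  have neg3: "Q (a, b, - c, d)" if "Q (a, b, c, d)" for a b c d
    using cyc[OF neg1[OF cyc[OF cyc[OF that]]]] .
  define Z where "Z = (0 :: int, 0 :: int)"
  have b: "Q ((0, 1), (1, 0), (-1, 1), Z)" using base by (simp add: base_def Z_def)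
  \<comment> \<open>The last coordinate of \<open>base\<close> is 0, so changes of the first three
    signs suffice.\<close>
  have signs: "Q (r, s, t, Z)"
    if "r \<in> {(0, 1), (0, -1)}" "s \<in> {(1, 0), (-1, 0)}" "t \<in> {(-1, 1), (1, -1)}" for r s t
    using that b neg1[OF b] neg2[OF b] neg3[OF b] neg1[OF neg2[OF b]] neg1[OF neg3[OF b]]
      neg2[OF neg3[OF b]] neg1[OF neg2[OF neg3[OF b]]] by auto
  \<comment> \<open>The twelve even permutations are the powers of \<open>cycle\<close> and the nine
    products of \<open>dbl_swap\<close> with a power of \<open>cycle\<close> on either side.\<close>
  have perms: "\<forall>y \<in> set (even_perms (a, b, c, d)). Q y" if "Q (a, b, c, d)" for a b c d
    using that cyc[OF that] cyc[OF cyc[OF that]] swp[OF that] cyc[OF swp[OF that]]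
      cyc[OF cyc[OF swp[OF that]]] swp[OF cyc[OF that]] cyc[OF swp[OF cyc[OF that]]]
      cyc[OF cyc[OF swp[OF cyc[OF that]]]] swp[OF cyc[OF cyc[OF that]]]
      cyc[OF swp[OF cyc[OF cyc[OF that]]]] cyc[OF cyc[OF swp[OF cyc[OF cyc[OF that]]]]]
    by simp
  have "\<forall>r\<in>{(0, 1), (0, -1)}. \<forall>s\<in>{(1, 0), (-1, 0)}. \<forall>t\<in>{(-1, 1), (1, -1)}.
      \<forall>y\<in>set (even_perms (r, s, t, Z)). Q y"
    using perms[OF signs] by blast
  then have "\<forall>y\<in>set V96. Q y"
    unfolding V96_def Z_def by (simp add: ball_Un del: even_perms.simps)
  then show ?thesis using assms(1) by (simp add: Q_def)
qed

section \<open>Rigid pairs and their symmetries\<close>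

definition rigid_pair :: "(golden quad \<Rightarrow> real quad) \<Rightarrow> golden quad \<Rightarrow> golden quad \<Rightarrow> bool" where
  "rigid_pair u x y \<longleftrightarrow> (u x - u y) \<bullet> (qval x - qval y) = 0"

definition motion :: "(golden quad \<Rightarrow> real quad) \<Rightarrow> bool" where
  "motion u \<longleftrightarrow> (\<forall>x\<in>set V96. \<forall>y\<in>set V96. adjacent x y \<longrightarrow> rigid_pair u x y)"

text \<open>Quantifying over all motions makes the relation invariant under symmetries, which
  transform \<open>u\<close> along with the vertices.\<close>

definition implied :: "golden quad \<Rightarrow> golden quad \<Rightarrow> bool" where
  "implied x y \<longleftrightarrow> (\<forall>u. motion u \<longrightarrow> rigid_pair u x y)"

text \<open>A motion \<open>u\<close> pulls back along the symmetry to \<open>h' (u (g x))\<close>.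
  Since \<open>h\<close> preserves differences and inner products, corresponding pairs satisfy the
  same bar equation.\<close>

lemma implied_transport:
  fixes g :: "golden quad \<Rightarrow> golden quad" and h h' :: "real quad \<Rightarrow> real quad"
  assumes implied: "implied x y"
    and closed: "\<And>x. x \<in> set V96 \<Longrightarrow> g x \<in> set V96"
    and gdot: "\<And>x y. gdot (g x) (g y) = gdot x y"
    and qval: "\<And>x. qval (g x) = h (qval x)"
    and inverse: "\<And>a. h (h' a) = a"
    and inner: "\<And>a b. h a \<bullet> h b = a \<bullet> b"
    and diff: "\<And>a b. h (a - b) = h a - h b"
  shows "implied (g x) (g y)"
  unfolding implied_def
proof (intro allI impI)
  fix u assume "motion u"
  define v where "v x = h' (u (g x))" for x
  have eq: "rigid_pair v x y \<longleftrightarrow> rigid_pair u (g x) (g y)" for x y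
  proof -
    have "(v x - v y) \<bullet> (qval x - qval y) = h (v x - v y) \<bullet> h (qval x - qval y)"
      by (simp only: inner)
    also have "\<dots> = (u (g x) - u (g y)) \<bullet> (qval (g x) - qval (g y))"
      by (simp only: diff v_def inverse qval)
    finally show ?thesis by (simp add: rigid_pair_def)
  qed
  have "motion v"
    using \<open>motion u\<close> closed by (auto simp: motion_def eq adjacent_def gdot)
  then have "rigid_pair v x y" using implied by (simp add: implied_def)
  then show "rigid_pair u (g x) (g y)" by (simp add: eq)
qed

lemma implied_flip: "implied x y \<Longrightarrow> implied (flip x) (flip y)"
  by (erule implied_transport[where h = flip and h' = flip])
    (auto simp: V96_flip qval_flip)

lemma implied_cycle: "implied x y \<Longrightarrow> implied (cycle x) (cycle y)"
  by (erule implied_transport[where h = cycle and h' = "cycle \<circ> cycle"])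
    (auto simp: V96_cycle qval_cycle)

lemma implied_dbl_swap: "implied x y \<Longrightarrow> implied (dbl_swap x) (dbl_swap y)"
  by (erule implied_transport[where h = dbl_swap and h' = dbl_swap])
    (auto simp: V96_dbl_swap qval_dbl_swap)

lemma diagonal_flip: "diagonal x y \<Longrightarrow> diagonal (flip x) (flip y)"
  and diagonal_cycle: "diagonal x y \<Longrightarrow> diagonal (cycle x) (cycle y)"
  and diagonal_dbl_swap: "diagonal x y \<Longrightarrow> diagonal (dbl_swap x) (dbl_swap y)"
  unfolding diagonal_def adjacent_def
  by (metis C24_flip gdot_flip, metis C24_cycle gdot_cycle, metis C24_dbl_swap gdot_dbl_swap)

text \<open>Virtual work: pairing the equilibrium equations with the velocities gives sum w_xy (u_x
  - u_y) . (x - y) = 0. Bars contribute 0, so the remaining pair \<open>p\<close>, \<open>q\<close>,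
  whose weight is nonzero, must be rigid.\<close>

lemma rigid_pair_if_stress:
  assumes stress: "is_stress B w L p q" and "distinct L"
    and bars: "\<And>x y. x \<in> set L \<Longrightarrow> y \<in> set L \<Longrightarrow> B x y \<Longrightarrow> rigid_pair u x y"
  shows "rigid_pair u p q"
proof (cases "p = q")
  case True
  then show ?thesis by (simp add: rigid_pair_def)
next
  case False
  define W where "W x y = gval (w x y)" for x y
  define e where "e x y = (u x - u y) \<bullet> (qval x - qval y)" for x y
  have pq: "p \<in> set L" "q \<in> set L" "W p q \<noteq> 0"
    using stress gval_nonzero by (auto simp: is_stress_def W_def)
  have sym: "W x y = W y x" and supp: "W x y * e x y = 0 \<or> (x = p \<and> y = q) \<or> (x = q \<and> y = p)"
    if "x \<in> set L" "y \<in> set L" for x y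
  proof -
    have "w y x = w x y"
      and "if w x y = 0 then True else if x = p \<and> y = q then True
        else if x = q \<and> y = p then True else B x y"
      using stress that by (simp_all add: is_stress_def supported_def)
    then show "W x y = W y x" "W x y * e x y = 0 \<or> (x = p \<and> y = q) \<or> (x = q \<and> y = p)"
      using bars[OF that] by (auto simp: W_def e_def rigid_pair_def split: if_splits)
  qed
  have equilibrium: "(\<Sum>y\<in>set L. W x y *\<^sub>R (qval y - qval x)) = 0" if "x \<in> set L" for x
  proof -
    have "(\<Sum>y\<leftarrow>L. gscale (w x y) (y - x)) = 0"
      using stress that by (simp add: is_stress_def balanced_def)
    then have "qval ((\<Sum>y\<leftarrow>L. gscale (w x y) (y - x))) = 0" by (simp only: qval_simps)
    then have "sum_list (map (\<lambda>y. W x y *\<^sub>R (qval y - qval x)) L) = 0"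
      by (simp add: qval_sum_list comp_def W_def)
    then show ?thesis using \<open>distinct L\<close> by (simp add: sum_list_distinct_conv_sum_set)
  qed
  define S where "S = (\<Sum>x\<in>set L. \<Sum>y\<in>set L. W x y * (u x \<bullet> (qval y - qval x)))"
  have "S = (\<Sum>x\<in>set L. u x \<bullet> (\<Sum>y\<in>set L. W x y *\<^sub>R (qval y - qval x)))"
    unfolding S_def by (simp add: inner_sum_right)
  then have "S = 0" by (simp add: equilibrium)
  \<comment> \<open>Exchanging the roles of x and y, with symmetric weights, turns this half of the
    work into \<open>S\<close>.\<close>
  have "(\<Sum>x\<in>set L. \<Sum>y\<in>set L. W x y * (u y \<bullet> (qval x - qval y))) = S"
    unfolding S_def by (subst sum.swap) (intro sum.cong refl, simp add: sym)
  then have "(\<Sum>x\<in>set L. \<Sum>y\<in>set L. W x y * (u y \<bullet> (qval x - qval y))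
      + W x y * (u x \<bullet> (qval y - qval x))) = 0"
    using \<open>S = 0\<close> by (simp add: sum.distrib S_def)
  moreover have "W x y * (u y \<bullet> (qval x - qval y)) + W x y * (u x \<bullet> (qval y - qval x))
      = - (W x y * e x y)" for x y
    by (simp add: e_def algebra_simps)
  ultimately have "(\<Sum>z\<in>set L \<times> set L. W (fst z) (snd z) * e (fst z) (snd z)) = 0"
    by (simp add: sum_negf sum.cartesian_product case_prod_unfold)
  \<comment> \<open>The double sum sees the pair in both orders, whence the factor 2.\<close>
  also have "(\<Sum>z\<in>set L \<times> set L. W (fst z) (snd z) * e (fst z) (snd z)) =
      (\<Sum>z\<in>{(p, q), (q, p)}. W (fst z) (snd z) * e (fst z) (snd z))"
  proof (rule sum.mono_neutral_right)
    show "\<forall>z\<in>set L \<times> set L - {(p, q), (q, p)}. W (fst z) (snd z) * e (fst z) (snd z) = 0"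
      using supp by (metis Diff_iff insertCI mem_Times_iff prod.collapse)
  qed (use pq in auto)
  also have "\<dots> = 2 * W p q * e p q"
    using False pq sym[of p q] by (simp add: e_def algebra_simps)
  finally show ?thesis using pq by (simp add: rigid_pair_def e_def)
qed

text \<open>Transitivity reduces to \<open>x = base\<close>, where the stress of an icosahedral cell
  containing both ends applies; its bars are edges.\<close>

lemma implied_diagonal:
  assumes "x \<in> set V96" "y \<in> set V96" "diagonal x y"
  shows "implied x y"
  using assms
proof (induction x arbitrary: y rule: V96_induct)
  case base
  then obtain c where c: "c \<in> set C24" "adjacent c base" "adjacent c y" "gdot base y = (2, 0)"
    by (auto simp: diagonal_def)
  then have "c \<in> set (filter (\<lambda>c. adjacent c base) C24)"
    and "y \<in> set (filter (\<lambda>q. gdot base q = (2, 0) \<and> adjacent c q) V96)"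
    using base by simp_all
  from bspec[OF bspec[OF ico_stress_base this(1)] this(2)]
  have stress: "is_stress adjacent (ico_stress base y) (filter (adjacent c) V96) base y" .
  show ?case unfolding implied_def
    by (intro allI impI, rule rigid_pair_if_stress[OF stress])
      (simp_all add: motion_def distinct_V96)
next
  case (flip x)
  then have "implied x (flip y)"
    using diagonal_flip[of "flip x" y] by (simp add: V96_flip)
  then show ?case using implied_flip[of x "flip y"] by simp
next
  case (cycle x)
  \<comment> \<open>\<open>cycle\<close> has order 3, so its square carries \<open>y\<close> back to
    the partner of \<open>x\<close>.\<close>
  then have "implied x (cycle (cycle y))"
    using diagonal_cycle[OF diagonal_cycle, of "cycle x" y] by (simp add: V96_cycle)
  then show ?case using implied_cycle[of x "cycle (cycle y)"] by simp
next
  case (dbl_swap x)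
  then have "implied x (dbl_swap y)"
    using diagonal_dbl_swap[of "dbl_swap x" y] by (simp add: V96_dbl_swap)
  then show ?case using implied_dbl_swap[of x "dbl_swap y"] by simp
qed

text \<open>After reduction to \<open>base\<close>, a pair in no common icosahedral cell is handled
  by the bipyramid stress, whose bars are edges and the diagonals already settled.\<close>

lemma implied_if_gdot_2:
  assumes "x \<in> set V96" "y \<in> set V96" "gdot x y = (2, 0)"
  shows "implied x y"
  using assms
proof (induction x arbitrary: y rule: V96_induct)
  case base
  show ?case
  proof (cases "diagonal base y")
    case True
    then show ?thesis using implied_diagonal base base_in_V96 by blast
  next
    case False
    then have "y \<in> set (filter (\<lambda>q. gdot base q = (2, 0) \<and> \<not> diagonal base q) V96)"
      using base by simp
    from bspec[OF bipyramid_stress_base this]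
    have stress: "is_stress (\<lambda>x y. if adjacent x y then True else diagonal x y) (bipyramid_stress base y)
        (filter (\<lambda>x. gdot x (base + y) \<in> {(6, 0), (0, 4), (4, 0)}) V96) base y" .
    show ?thesis unfolding implied_def
    proof (intro allI impI)
      fix u assume u: "motion u"
      show "rigid_pair u base y"
      proof (rule rigid_pair_if_stress[OF stress])
        fix x z
        assume "x \<in> set (filter (\<lambda>x. gdot x (base + y) \<in> {(6, 0), (0, 4), (4, 0)}) V96)"
          and "z \<in> set (filter (\<lambda>x. gdot x (base + y) \<in> {(6, 0), (0, 4), (4, 0)}) V96)"
          and bar: "if adjacent x z then True else diagonal x z"
        then have xz: "x \<in> set V96" "z \<in> set V96" by simp_all
        show "rigid_pair u x z"
        proof (cases "adjacent x z")
          case True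
          then show ?thesis using u xz by (simp add: motion_def)
        next
          case False
          then have "implied x z" using bar implied_diagonal[OF xz] by simp
          then show ?thesis using u by (simp add: implied_def)
        qed
      qed (simp add: distinct_V96)
    qed
  qed
next
  case (flip x)
  then have "implied x (flip y)"
    using gdot_flip[of "flip x" y] by (simp add: V96_flip)
  then show ?case using implied_flip[of x "flip y"] by simp
next
  case (cycle x)
  then have "implied x (cycle (cycle y))"
    using gdot_cycle[of "cycle x" y] gdot_cycle[of "cycle (cycle x)" "cycle y"] by (simp add: V96_cycle)
  then show ?case using implied_cycle[of x "cycle (cycle y)"] by simp
next
  case (dbl_swap x)
  then have "implied x (dbl_swap y)"
    using gdot_dbl_swap[of "dbl_swap x" y] by (simp add: V96_dbl_swap)
  then show ?case using implied_dbl_swap[of x "dbl_swap y"] by simp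
qed

text \<open>Cramer's rule: up to sign, the determinant times each coordinate of \<open>v\<close> is
  a combination of the four inner products, with 3 x 3 cofactors as coefficients.\<close>

lemma orthogonal_to_basis_zero:
  assumes "v \<bullet> qval a = 0" "v \<bullet> qval b = 0" "v \<bullet> qval c = 0" "v \<bullet> qval d = 0"
    and det: "gval (gdet a b c d) \<noteq> 0"
  shows "v = 0"
proof -
  obtain a0 a1 a2 a3 where a: "a = (a0, a1, a2, a3)" by (rule prod_cases4)
  obtain b0 b1 b2 b3 where b: "b = (b0, b1, b2, b3)" by (rule prod_cases4)
  obtain c0 c1 c2 c3 where c: "c = (c0, c1, c2, c3)" by (rule prod_cases4)
  obtain d0 d1 d2 d3 where d: "d = (d0, d1, d2, d3)" by (rule prod_cases4)
  obtain v0 v1 v2 v3 where v: "v = (v0, v1, v2, v3)" by (rule prod_cases4)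
  define p where "p x y x' y' = gval x * gval y' - gval y * gval x'" for x y x' y'
  define D where "D = gval (gdet a b c d)"
  have D: "D = p a0 a1 b0 b1 * p c2 c3 d2 d3 - p a0 a2 b0 b2 * p c1 c3 d1 d3
      + p a0 a3 b0 b3 * p c1 c2 d1 d2 + p a1 a2 b1 b2 * p c0 c3 d0 d3
      - p a1 a3 b1 b3 * p c0 c2 d0 d2 + p a2 a3 b2 b3 * p c0 c1 d0 d1"
    by (simp add: D_def a b c d p_def Let_def)
  define ra where "ra = v0 * gval a0 + v1 * gval a1 + v2 * gval a2 + v3 * gval a3"
  define rb where "rb = v0 * gval b0 + v1 * gval b1 + v2 * gval b2 + v3 * gval b3"
  define rc where "rc = v0 * gval c0 + v1 * gval c1 + v2 * gval c2 + v3 * gval c3"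
  define rd where "rd = v0 * gval d0 + v1 * gval d1 + v2 * gval d2 + v3 * gval d3"
  have zero: "ra = 0" "rb = 0" "rc = 0" "rd = 0"
    using assms(1-4) by (simp_all add: a b c d v ra_def rb_def rc_def rd_def)
  have "D * v0 = (gval b1 * p c2 c3 d2 d3 - gval b2 * p c1 c3 d1 d3 + gval b3 * p c1 c2 d1 d2) * ra
      - (gval a1 * p c2 c3 d2 d3 - gval a2 * p c1 c3 d1 d3 + gval a3 * p c1 c2 d1 d2) * rb
      + (gval d1 * p a2 a3 b2 b3 - gval d2 * p a1 a3 b1 b3 + gval d3 * p a1 a2 b1 b2) * rc
      - (gval c1 * p a2 a3 b2 b3 - gval c2 * p a1 a3 b1 b3 + gval c3 * p a1 a2 b1 b2) * rd"
    unfolding D p_def ra_def rb_def rc_def rd_def by (simp add: algebra_simps)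
  moreover have "- D * v1 = (gval b0 * p c2 c3 d2 d3 - gval b2 * p c0 c3 d0 d3 + gval b3 * p c0 c2 d0 d2) * ra
      - (gval a0 * p c2 c3 d2 d3 - gval a2 * p c0 c3 d0 d3 + gval a3 * p c0 c2 d0 d2) * rb
      + (gval d0 * p a2 a3 b2 b3 - gval d2 * p a0 a3 b0 b3 + gval d3 * p a0 a2 b0 b2) * rc
      - (gval c0 * p a2 a3 b2 b3 - gval c2 * p a0 a3 b0 b3 + gval c3 * p a0 a2 b0 b2) * rd"
    unfolding D p_def ra_def rb_def rc_def rd_def by (simp add: algebra_simps)
  moreover have "D * v2 = (gval b0 * p c1 c3 d1 d3 - gval b1 * p c0 c3 d0 d3 + gval b3 * p c0 c1 d0 d1) * ra
      - (gval a0 * p c1 c3 d1 d3 - gval a1 * p c0 c3 d0 d3 + gval a3 * p c0 c1 d0 d1) * rb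
      + (gval d0 * p a1 a3 b1 b3 - gval d1 * p a0 a3 b0 b3 + gval d3 * p a0 a1 b0 b1) * rc
      - (gval c0 * p a1 a3 b1 b3 - gval c1 * p a0 a3 b0 b3 + gval c3 * p a0 a1 b0 b1) * rd"
    unfolding D p_def ra_def rb_def rc_def rd_def by (simp add: algebra_simps)
  moreover have "- D * v3 = (gval b0 * p c1 c2 d1 d2 - gval b1 * p c0 c2 d0 d2 + gval b2 * p c0 c1 d0 d1) * ra
      - (gval a0 * p c1 c2 d1 d2 - gval a1 * p c0 c2 d0 d2 + gval a2 * p c0 c1 d0 d1) * rb
      + (gval d0 * p a1 a2 b1 b2 - gval d1 * p a0 a2 b0 b2 + gval d2 * p a0 a1 b0 b1) * rc
      - (gval c0 * p a1 a2 b1 b2 - gval c1 * p a0 a2 b0 b2 + gval c2 * p a0 a1 b0 b1) * rd"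
    unfolding D p_def ra_def rb_def rc_def rd_def by (simp add: algebra_simps)
  ultimately show ?thesis using zero det by (simp add: v D_def[symmetric] zero_prod_def)
qed

section \<open>Propagation along the pinning chain\<close>

lemma length_V96: "length V96 = 96"
  by (simp add: V96_def)

text \<open>With the four partners at rest, the bar equations make \<open>u x\<close> orthogonal to
  four independent directions.\<close>

lemma zero_if_pinned:
  assumes "motion u" and "pinned x p q r s"
    and V: "x \<in> set V96" "p \<in> set V96" "q \<in> set V96" "r \<in> set V96" "s \<in> set V96"
    and zero: "u p = 0" "u q = 0" "u r = 0" "u s = 0"
  shows "u x = 0"
proof (rule orthogonal_to_basis_zero)
  have bar: "u x \<bullet> qval (x - y) = 0" if "y \<in> {p, q, r, s}" for y
  proof -
    have "rigid_pair u x y"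
    proof (cases "adjacent x y")
      case True
      then show ?thesis using \<open>motion u\<close> V that by (auto simp: motion_def)
    next
      case False
      then have "gdot x y = (2, 0)" using assms(2) that by (auto simp: pinned_def adjacent_def)
      then show ?thesis using \<open>motion u\<close> implied_if_gdot_2[of x y] V that by (auto simp: implied_def)
    qed
    moreover have "u y = 0" using that zero by auto
    ultimately show ?thesis by (simp add: rigid_pair_def)
  qed
  show "u x \<bullet> qval (x - p) = 0" "u x \<bullet> qval (x - q) = 0"
    "u x \<bullet> qval (x - r) = 0" "u x \<bullet> qval (x - s) = 0"
    by (rule bar; simp)+
  show "gval (gdet (x - p) (x - q) (x - r) (x - s)) \<noteq> 0"
    using assms(2) gval_nonzero by (simp add: pinned_def)
qed

lemma zero_if_spreads:
  assumes "motion u" and "spreads K cs" and "\<And>i. i \<in> set K \<Longrightarrow> i < 96 \<Longrightarrow> u (V96 ! i) = 0" and "i < 96"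
  shows "u (V96 ! i) = 0"
  using assms(2-4)
proof (induction K cs arbitrary: i rule: spreads.induct)
  case (1 K)
  then show ?case by simp
next
  case (2 K j a b c d cs)
  have "u (V96 ! j) = 0"
    by (rule zero_if_pinned[OF \<open>motion u\<close>, of _ "V96 ! a" "V96 ! b" "V96 ! c" "V96 ! d"])
      (use 2 length_V96 in auto)
  then show ?case using 2 by auto
qed

text \<open>In matrix terms W sums w_i f_i^T - f_i w_i^T and (w_i . d_j) f_i f_j^T. The former is
  skew by its form, the latter by hypothesis; at \<open>d k\<close> the last two terms cancel and
  leave \<open>w k\<close>.\<close>

lemma skew_extension:
  fixes d f w :: "'i \<Rightarrow> 'a::real_inner"
  assumes "finite I"
    and dual: "\<And>i j. i \<in> I \<Longrightarrow> j \<in> I \<Longrightarrow> f i \<bullet> d j = (if i = j then 1 else 0)"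
    and skew: "\<And>i j. i \<in> I \<Longrightarrow> j \<in> I \<Longrightarrow> w i \<bullet> d j + d i \<bullet> w j = 0"
  obtains W where "linear W" "\<And>a b. a \<bullet> W b = - (W a \<bullet> b)" "\<And>i. i \<in> I \<Longrightarrow> W (d i) = w i"
proof -
  define W where "W y = (\<Sum>i\<in>I. (f i \<bullet> y) *\<^sub>R w i - (w i \<bullet> y) *\<^sub>R f i)
    + (\<Sum>i\<in>I. \<Sum>j\<in>I. ((w i \<bullet> d j) * (f j \<bullet> y)) *\<^sub>R f i)" for y
  have "linear W"
    unfolding W_def
    by (intro linearI)
      (simp_all add: inner_add_right algebra_simps sum.distrib sum_subtractf scaleR_sum_right)
  moreover have "a \<bullet> W b = - (W a \<bullet> b)" for a b
  proof -
    define T where "T a b = (\<Sum>i\<in>I. \<Sum>j\<in>I. (w i \<bullet> d j) * (f j \<bullet> b) * (f i \<bullet> a))" for a b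
    have W: "a \<bullet> W b = (\<Sum>i\<in>I. (f i \<bullet> b) * (w i \<bullet> a)) - (\<Sum>i\<in>I. (w i \<bullet> b) * (f i \<bullet> a)) + T a b" for a b
      by (simp add: W_def T_def inner_add_right inner_diff_right inner_sum_right sum_subtractf
          inner_commute)
    have "T b a = (\<Sum>j\<in>I. \<Sum>i\<in>I. (w i \<bullet> d j) * (f j \<bullet> a) * (f i \<bullet> b))"
      unfolding T_def by (rule sum.swap)
    also have "\<dots> = (\<Sum>j\<in>I. \<Sum>i\<in>I. - ((w j \<bullet> d i) * (f i \<bullet> b) * (f j \<bullet> a)))"
    proof (intro sum.cong refl)
      fix i j assume "i \<in> I" "j \<in> I"
      then have "w i \<bullet> d j = - (w j \<bullet> d i)" using skew[of i j] by (simp add: inner_commute)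
      then show "(w i \<bullet> d j) * (f j \<bullet> a) * (f i \<bullet> b) = - ((w j \<bullet> d i) * (f i \<bullet> b) * (f j \<bullet> a))"
        by simp
    qed
    also have "\<dots> = - T a b" by (simp add: T_def sum_negf)
    finally show ?thesis using W[of a b] W[of b a] by (simp add: inner_commute mult.commute)
  qed
  moreover have "W (d k) = w k" if k: "k \<in> I" for k
  proof -
    have 1: "(\<Sum>j\<in>I. ((w i \<bullet> d j) * (f j \<bullet> d k)) *\<^sub>R f i) = (w i \<bullet> d k) *\<^sub>R f i" for i
    proof -
      have "(\<Sum>j\<in>I. ((w i \<bullet> d j) * (f j \<bullet> d k)) *\<^sub>R f i) =
          (\<Sum>j\<in>I. if j = k then (w i \<bullet> d k) *\<^sub>R f i else 0)"
        by (intro sum.cong refl) (use dual k in auto)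
      then show ?thesis using \<open>finite I\<close> k by simp
    qed
    have "(\<Sum>i\<in>I. (f i \<bullet> d k) *\<^sub>R w i) = (\<Sum>i\<in>I. if i = k then w k else 0)"
      by (intro sum.cong refl) (use dual k in auto)
    then have 2: "(\<Sum>i\<in>I. (f i \<bullet> d k) *\<^sub>R w i) = w k" using \<open>finite I\<close> k by simp
    show ?thesis unfolding W_def 1 by (simp add: sum_subtractf 2)
  qed
  ultimately show ?thesis by (rule that)
qed

lemma motion_is_infinitesimal_isometry:
  assumes "motion u"
  obtains b W where "linear W" "\<And>x y. x \<bullet> W y = - (W x \<bullet> y)"
    "\<And>x. x \<in> set V96 \<Longrightarrow> u x = b + W (qval x)"
proof -
  \<comment> \<open>The initial vertices of the chain. All have first coordinate tau, so the
    differences \<open>d i\<close> span the hyperplane of vectors with first coordinate 0.\<close>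
  define K where "K = [0, 8, 12, 20 :: nat]"
  define t where "t i = V96 ! (K ! i)" for i
  have t: "t 0 = ((0, 1), (1, 0), (-1, 1), (0, 0))" "t 1 = ((0, 1), (-1, 1), (0, 0), (1, 0))"
    "t 2 = ((0, 1), (1, 0), (1, -1), (0, 0))" "t 3 = ((0, 1), (1, -1), (0, 0), (1, 0))"
    by (simp_all add: t_def K_def V96_def numeral_3_eq_3 eval_nat_numeral)
  have tV: "t i \<in> set V96" if "i < 4" for i
    unfolding t_def using that by (intro nth_mem) (auto simp: length_V96 K_def less_Suc_eq numeral_eq_Suc)
  define d where "d i = qval (t i) - qval (t 0)" for i
  define w where "w i = u (t i) - u (t 0)" for i
  have pair: "(u (t i) - u (t j)) \<bullet> (qval (t i) - qval (t j)) = 0" if "i < 4" "j < 4" for i j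
  proof (cases "i = j")
    case False
    have "\<forall>i\<in>{0, 1, 2, 3}. \<forall>j\<in>{0, 1, 2, 3}. i \<noteq> j \<longrightarrow>
        adjacent (t i) (t j) \<or> gdot (t i) (t j) = (2, 0)"
      by (simp add: t adjacent_def del: One_nat_def)
    moreover have "i \<in> {0, 1, 2, 3}" "j \<in> {0, 1, 2, 3}" using that by auto
    ultimately have "adjacent (t i) (t j) \<or> gdot (t i) (t j) = (2, 0)" using False by blast
    then have "rigid_pair u (t i) (t j)"
    proof
      assume "adjacent (t i) (t j)"
      then show ?thesis
        using assms tV[OF that(1)] tV[OF that(2)] unfolding motion_def by blast
    next
      assume "gdot (t i) (t j) = (2, 0)"
      then show ?thesis
        using assms implied_if_gdot_2[OF tV[OF that(1)] tV[OF that(2)]] unfolding implied_def by blast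
    qed
    then show ?thesis by (simp add: rigid_pair_def)
  qed simp
  have skew: "w i \<bullet> d j + d i \<bullet> w j = 0" if "i < 4" "j < 4" for i j
  proof -
    \<comment> \<open>Polarisation: each term on the right is the bar equation of a pair among the
      four vertices.\<close>
    have "w i \<bullet> d j + d i \<bullet> w j = w i \<bullet> d i + w j \<bullet> d j - (w i - w j) \<bullet> (d i - d j)"
      by (simp add: algebra_simps inner_commute)
    also have "(w i - w j) \<bullet> (d i - d j) = (u (t i) - u (t j)) \<bullet> (qval (t i) - qval (t j))"
      by (simp add: w_def d_def)
    finally show ?thesis using that pair by (simp add: w_def d_def)
  qed
  \<comment> \<open>The basis of that hyperplane dual to \<open>d 1\<close>, \<open>d 2\<close>,
    \<open>d 3\<close>.\<close>
  define f :: "nat \<Rightarrow> real quad" where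
    "f i = (if i = 1 then (0, tau / 2, 0, (tau + 1) / 2)
            else if i = 2 then (0, 0, - tau / 2, - 1 / 2)
            else (0, - tau / 2, 0, (1 - tau) / 2))" for i
  have d: "d 1 = (0, tau - 2, 1 - tau, 1)" "d 2 = (0, 0, 2 - 2 * tau, 0)" "d 3 = (0, - tau, 1 - tau, 1)"
    by (simp_all add: d_def t del: One_nat_def)
  have tau_tau: "tau * (tau * r) = tau * r + r" for r
    by (simp add: mult.assoc[symmetric] tau_square algebra_simps)
  have "f 1 \<bullet> d 1 = 1" "f 1 \<bullet> d 2 = 0" "f 1 \<bullet> d 3 = 0" "f 2 \<bullet> d 1 = 0" "f 2 \<bullet> d 2 = 1"
    "f 2 \<bullet> d 3 = 0" "f 3 \<bullet> d 1 = 0" "f 3 \<bullet> d 2 = 0" "f 3 \<bullet> d 3 = 1"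
    unfolding d f_def by (simp_all add: field_simps tau_square tau_tau)
  then have dual: "f i \<bullet> d j = (if i = j then 1 else 0)" if "i \<in> {1, 2, 3}" "j \<in> {1, 2, 3}" for i j
    using that by (elim insertE emptyE) simp_all
  obtain W where W: "linear W" "\<And>a b. a \<bullet> W b = - (W a \<bullet> b)" "\<And>i. i \<in> {1, 2, 3} \<Longrightarrow> W (d i) = w i"
    by (rule skew_extension[of "{1, 2, 3 :: nat}" f d w]) (use dual skew in auto)
  \<comment> \<open>This choice makes the difference \<open>v\<close> vanish at \<open>t 0\<close>;
    the values of \<open>W\<close> on the \<open>d i\<close> then make it vanish at the other three
    vertices.\<close>
  define b where "b = u (t 0) - W (qval (t 0))"
  define v where "v x = u x - (b + W (qval x))" for x
  have "motion v"
    unfolding motion_def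
  proof (intro ballI impI)
    fix x y assume xy: "x \<in> set V96" "y \<in> set V96" "adjacent x y"
    \<comment> \<open>A skew map moves each bar orthogonally to itself, so \<open>v\<close> inherits
      the bar equations of \<open>u\<close>.\<close>
    have "W (qval x - qval y) \<bullet> (qval x - qval y) = 0"
      using W(2)[of "qval x - qval y" "qval x - qval y"] by (simp add: inner_commute)
    then have "(v x - v y) \<bullet> (qval x - qval y) = (u x - u y) \<bullet> (qval x - qval y)"
      by (simp add: v_def linear_diff[OF W(1)] algebra_simps)
    then show "rigid_pair v x y"
      using assms xy by (simp add: motion_def rigid_pair_def)
  qed
  have "v (t i) = 0" if "i \<in> {0, 1, 2, 3}" for i
  proof (cases "i = 0")
    case False
    then have "W (qval (t i)) - W (qval (t 0)) = u (t i) - u (t 0)"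
      using that W(3)[of i] by (auto simp: d_def w_def linear_diff[OF W(1)])
    then show ?thesis by (simp add: v_def b_def algebra_simps)
  qed (simp add: v_def b_def)
  then have "v (V96 ! i) = 0" if "i \<in> set [0, 8, 12, 20]" for i
    using that by (force simp: t_def K_def numeral_eq_Suc)
  then have "v x = 0" if "x \<in> set V96" for x
    using that zero_if_spreads[OF \<open>motion v\<close> spreads_spreading] by (metis in_set_conv_nth length_V96)
  then show ?thesis using that[of W b] W by (simp add: v_def)
qed

section \<open>Walls and their intersections\<close>

lemma exhaust_5: "(i :: 5) = 0 \<or> i = 1 \<or> i = 2 \<or> i = 3 \<or> i = 4"
proof (induct i)
  case (of_int z)
  then have "z = 0 \<or> z = 1 \<or> z = 2 \<or> z = 3 \<or> z = 4" by auto
  then show ?case by auto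
qed

lemma UNIV_5: "(UNIV :: 5 set) = {0, 1, 2, 3, 4}"
  using exhaust_5 by auto

lemma distinct_5:
  "(0::5) \<noteq> 1" "(0::5) \<noteq> 2" "(0::5) \<noteq> 3" "(0::5) \<noteq> 4" "(1::5) \<noteq> 2" "(1::5) \<noteq> 3" "(1::5) \<noteq> 4"
  "(2::5) \<noteq> 3" "(2::5) \<noteq> 4" "(3::5) \<noteq> 4"
  by simp_all

lemma vec_eq_5:
  fixes v w :: "'a^5"
  shows "v = w \<longleftrightarrow> v$0 = w$0 \<and> v$1 = w$1 \<and> v$2 = w$2 \<and> v$3 = w$3 \<and> v$4 = w$4"
  unfolding vec_eq_iff by (metis exhaust_5)

lemma sum_5: "(\<Sum>i\<in>(UNIV :: 5 set). f i) = f 0 + f 1 + f 2 + f 3 + f 4"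
  for f :: "5 \<Rightarrow> 'a::comm_monoid_add"
  unfolding UNIV_5 using distinct_5 by (simp add: ac_simps)

fun mkvec :: "real \<Rightarrow> real quad \<Rightarrow> real^5" where
  "mkvec r (a, b, c, d) = (\<chi> i. if i = 0 then r else if i = 1 then a else if i = 2 then b
     else if i = 3 then c else d)"

lemma mkvec_nth [simp]:
  "mkvec r (a, b, c, d) $ 0 = r" "mkvec r (a, b, c, d) $ 1 = a" "mkvec r (a, b, c, d) $ 2 = b"
  "mkvec r (a, b, c, d) $ 3 = c" "mkvec r (a, b, c, d) $ 4 = d"
  by simp_all

definition spatial :: "real^5 \<Rightarrow> real quad" where
  "spatial v = (v$1, v$2, v$3, v$4)"

declare mkvec.simps [simp del]

lemma mkvec_0: "mkvec r p $ 0 = r"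
  by (cases p rule: prod_cases4) simp

lemma spatial_mkvec [simp]: "spatial (mkvec r p) = p"
  by (cases p rule: prod_cases4) (simp add: spatial_def)

lemma mkvec_spatial: "mkvec (v$0) (spatial v) = v"
  by (simp add: spatial_def vec_eq_5)

lemma mink_mkvec: "mink (mkvec r p) (mkvec s q) = p \<bullet> q - r * s"
  by (cases p rule: prod_cases4; cases q rule: prod_cases4) (simp add: mink_def)

definition wall_normal :: "golden quad \<Rightarrow> real^5" where
  "wall_normal x = mkvec (sqrt (2 * tau)) (qval x)"

lemma mink_wall_normal: "mink (wall_normal x) (wall_normal y) = qval x \<bullet> qval y - 2 * tau"
  using tau_bounds by (simp add: wall_normal_def mink_mkvec)

lemma vec5_eq_mkvec: "vec5 f = mkvec (f 0) (f 1, f 2, f 3, f 4)"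
  by (simp add: vec5_def vec_eq_5)

section \<open>Even permutations of four coordinates\<close>

lemma permutes_insert_iff:
  "\<sigma> permutes insert a S \<longleftrightarrow> (\<exists>b\<in>insert a S. \<exists>p. p permutes S \<and> \<sigma> = Transposition.transpose a b \<circ> p)"
proof -
  have "\<sigma> permutes insert a S \<longleftrightarrow> \<sigma> \<in> {p. p permutes insert a S}" by simp
  also have "\<dots> \<longleftrightarrow> (\<exists>b\<in>insert a S. \<exists>p. p permutes S \<and> \<sigma> = Transposition.transpose a b \<circ> p)"
    unfolding permutes_insert by (auto simp: image_iff)
  finally show ?thesis .
qed

text \<open>Peeling off one point at a time writes a permutation as a product (1 b)(2 c)(3 d) with b
  \<ge> 1, c \<ge> 2, d \<ge> 3.\<close>

lemma permutes_4:
  "{\<sigma>. \<sigma> permutes {1..4::nat}} =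
    (\<lambda>(b, c, d). Transposition.transpose 1 b \<circ> (Transposition.transpose 2 c \<circ> Transposition.transpose 3 d)) `
      ({1, 2, 3, 4} \<times> {2, 3, 4} \<times> {3, 4})"
proof -
  have four: "{1..4::nat} = insert 1 (insert 2 (insert 3 {4}))" by auto
  have "\<sigma> permutes {1..4::nat} \<longleftrightarrow> (\<exists>b\<in>{1, 2, 3, 4}. \<exists>c\<in>{2, 3, 4}. \<exists>d\<in>{3, 4}.
      \<sigma> = Transposition.transpose 1 b \<circ> (Transposition.transpose 2 c \<circ> Transposition.transpose 3 d))" for \<sigma>
    unfolding four permutes_insert_iff[of _ 1 "{2, 3, 4}"] permutes_insert_iff[of _ 2 "{3, 4}"]
      permutes_insert_iff[of _ 3 "{4}"] permutes_sing by (simp only: simp_thms comp_id) blast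
  then show ?thesis
    by (simp only: set_eq_iff mem_Collect_eq image_iff split_paired_Bex_Sigma prod.case simp_thms)
qed

lemma even_permutations_4:
  "{(g (\<sigma> 1), g (\<sigma> 2), g (\<sigma> 3), g (\<sigma> 4)) | \<sigma>. \<sigma> permutes {1..4::nat} \<and> evenperm \<sigma>} =
    set (even_perms (g 1, g 2, g 3, g 4))"
proof -
  define F :: "nat \<times> nat \<times> nat \<Rightarrow> nat \<Rightarrow> nat" where
    "F = (\<lambda>(b, c, d). Transposition.transpose 1 b \<circ> (Transposition.transpose 2 c \<circ> Transposition.transpose 3 d))"
  define S :: "(nat \<times> nat \<times> nat) set" where "S = {1, 2, 3, 4} \<times> {2, 3, 4} \<times> {3, 4}"
  \<comment> \<open>A factor is the identity exactly when its entries agree; the nested equivalence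
    says that the number of proper transpositions is even.\<close>
  have even: "evenperm (F (b, c, d)) \<longleftrightarrow> ((1 = b) = ((2 = c) = (3 = d)))" for b c d
    by (simp add: F_def evenperm_comp permutation_compose permutation_swap_id evenperm_swap)
  have S: "{s \<in> S. evenperm (F s)} = {(1, 2, 3), (2, 3, 3), (3, 3, 3), (2, 2, 4), (1, 4, 4),
      (4, 2, 4), (3, 4, 3), (4, 4, 3), (1, 3, 4), (4, 3, 3), (3, 2, 4), (2, 4, 3)}"
    (is "?L = ?R")
  proof
    show "?L \<subseteq> ?R"
    proof
      fix s assume s: "s \<in> ?L"
      obtain b c d where bcd: "s = (b, c, d)" by (rule prod_cases3)
      then have "b \<in> {1, 2, 3, 4}" "c \<in> {2, 3, 4}" "d \<in> {3, 4}" "(1 = b) = ((2 = c) = (3 = d))"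
        using s even[of b c d] by (simp_all only: S_def mem_Collect_eq mem_Sigma_iff)
      then show "s \<in> ?R"
        unfolding bcd by (elim insertE emptyE; simp)
    qed
    show "?R \<subseteq> ?L" by (simp add: S_def even)
  qed
  have "{(g (\<sigma> 1), g (\<sigma> 2), g (\<sigma> 3), g (\<sigma> 4)) | \<sigma>. \<sigma> permutes {1..4::nat} \<and> evenperm \<sigma>} =
     (\<lambda>\<sigma>. (g (\<sigma> 1), g (\<sigma> 2), g (\<sigma> 3), g (\<sigma> 4))) ` {\<sigma> \<in> {\<sigma>. \<sigma> permutes {1..4}}. evenperm \<sigma>}"
    by auto
  also have "{\<sigma> \<in> {\<sigma>. \<sigma> permutes {1..4}}. evenperm \<sigma>} = F ` {s \<in> S. evenperm (F s)}"
    unfolding permutes_4 F_def[symmetric] S_def[symmetric] by blast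
  finally show ?thesis
    unfolding S by (simp add: F_def Transposition.transpose_def)
qed

lemma qval_even_perms: "qval ` set (even_perms (a, b, c, d)) = set (even_perms (gval a, gval b, gval c, gval d))"
  by simp

text \<open>The identity 1/tau = tau - 1 moves the spatial coordinates into the golden
  integers.\<close>

lemma normals96_eq: "normals96 = wall_normal ` set V96"
proof -
  define g where "g s1 s2 s3 j = (if j = 1 then s1 * tau else if j = 2 then s2
     else if j = 3 then s3 / tau else 0)" for s1 s2 s3 :: real and j :: nat
  define Sg where "Sg = {-1, 1 :: real}"
  have "normals96 = (\<Union>s1\<in>Sg. \<Union>s2\<in>Sg. \<Union>s3\<in>Sg. mkvec (sqrt (2 * tau)) `
      {(g s1 s2 s3 (\<sigma> 1), g s1 s2 s3 (\<sigma> 2), g s1 s2 s3 (\<sigma> 3), g s1 s2 s3 (\<sigma> 4)) | \<sigma>.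
        \<sigma> permutes {1..4::nat} \<and> evenperm \<sigma>})"
    unfolding normals96_def vec5_eq_mkvec Sg_def[symmetric] g_def[symmetric] by auto blast
  also have "\<dots> = (\<Union>s1\<in>Sg. \<Union>s2\<in>Sg. \<Union>s3\<in>Sg. mkvec (sqrt (2 * tau)) `
      set (even_perms (s1 * tau, s2, s3 * (1 / tau), 0)))"
    unfolding even_permutations_4 by (simp add: g_def)
  also have "\<dots> = mkvec (sqrt (2 * tau)) ` (\<Union>s1\<in>Sg. \<Union>s2\<in>Sg. \<Union>s3\<in>Sg.
      set (even_perms (s1 * tau, s2, s3 * (tau - 1), 0)))"
    unfolding image_UN inverse_tau ..
  also have "(\<Union>s1\<in>Sg. \<Union>s2\<in>Sg. \<Union>s3\<in>Sg.
      set (even_perms (s1 * tau, s2, s3 * (tau - 1), 0))) = qval ` set V96"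
    by (simp add: Sg_def V96_def image_Un qval_even_perms Un_ac del: even_perms.simps)
  finally show ?thesis by (simp add: image_image wall_normal_def)
qed

lemma normalsC_subset: "normalsC \<subseteq> wall_normal ` set C24"
proof -
  have four: "{1..4::nat} = {1, 2, 3, 4}" by auto
  have "\<exists>p\<in>set C24. vec5 (\<lambda>k. if k = 0 then sqrt (2 * tau) else if k = m then s * 2 else 0) = wall_normal p"
    if "m \<in> {1..4}" "s \<in> {-1, 1}" for m :: nat and s :: real
    using that unfolding four vec5_eq_mkvec wall_normal_def C24_def
    by (auto simp: zero_prod_def)
  moreover have "\<exists>p\<in>set C24. vec5 (\<lambda>k. if k = 0 then sqrt (2 * tau) else s k) = wall_normal p"
    if "\<forall>k\<in>{1..4}. s k \<in> {-1, 1}" for s :: "nat \<Rightarrow> real"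
  proof -
    have "s 1 \<in> {-1, 1}" "s 2 \<in> {-1, 1}" "s 3 \<in> {-1, 1}" "s 4 \<in> {-1, 1}"
      using that by auto
    then show ?thesis unfolding vec5_eq_mkvec wall_normal_def C24_def by auto
  qed
  ultimately show ?thesis unfolding normalsC_def by blast
qed

lemma gdot_self: "x \<in> set V96 \<Longrightarrow> gdot x x = (4, 0)"
  by (induction x rule: V96_induct) (simp_all add: base_def)

text \<open>The values in \<open>gdot_base\<close> are carried to every vertex by the
  symmetries.\<close>

lemma inner_le_if_normals:
  assumes "x \<in> set V96" "k \<in> set (V96 @ C24)" "k \<noteq> x"
  shows "qval k \<bullet> qval x \<le> 2 * tau"
proof -
  define vals :: "golden set" where
    "vals = {(0, 2), (2, 0), (-2, 2), (0, 0), (2, -2), (-2, 0), (0, -2), (-4, 0)}"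
  have "\<forall>k\<in>set (V96 @ C24). k = x \<or> gdot k x \<in> vals"
    using assms(1)
  proof (induction x rule: V96_induct)
    case base
    show ?case using gdot_base unfolding vals_def .
  next
    case (flip x)
    show ?case
    proof
      fix k assume "k \<in> set (V96 @ C24)"
      then have "flip k \<in> set (V96 @ C24)" by (auto simp: V96_flip C24_flip)
      from bspec[OF flip.IH this] show "k = flip x \<or> gdot k (flip x) \<in> vals"
        using gdot_flip[of "flip k" x] by auto
    qed
  next
    case (cycle x)
    show ?case
    proof
      fix k assume "k \<in> set (V96 @ C24)"
      then have "cycle (cycle k) \<in> set (V96 @ C24)" by (auto simp: V96_cycle C24_cycle)
      from bspec[OF cycle.IH this] show "k = cycle x \<or> gdot k (cycle x) \<in> vals"
        using gdot_cycle[of "cycle (cycle k)" x] by auto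
    qed
  next
    case (dbl_swap x)
    show ?case
    proof
      fix k assume "k \<in> set (V96 @ C24)"
      then have "dbl_swap k \<in> set (V96 @ C24)" by (auto simp: V96_dbl_swap C24_dbl_swap)
      from bspec[OF dbl_swap.IH this] show "k = dbl_swap x \<or> gdot k (dbl_swap x) \<in> vals"
        using gdot_dbl_swap[of "dbl_swap k" x] by auto
    qed
  qed
  then have "gdot k x \<in> vals" using assms by blast
  then have "gval (gdot k x) \<le> 2 * tau" using tau_bounds unfolding vals_def by auto
  then show ?thesis by (simp add: gval_gdot)
qed

section \<open>Intersecting walls\<close>

lemma mink_scaleR: "mink (a *\<^sub>R x) y = a * mink x y" "mink x (a *\<^sub>R y) = a * mink x y"
  and mink_add: "mink (x + z) y = mink x y + mink z y" "mink x (y + z) = mink x y + mink x z"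
  and mink_diff: "mink (x - z) y = mink x y - mink z y" "mink x (y - z) = mink x y - mink x z"
  and mink_minus: "mink (- x) y = - mink x y" "mink x (- y) = - mink x y"
  and mink_commute: "mink x y = mink y x"
  by (simp_all add: mink_def algebra_simps)

text \<open>The sum of the two normals with adjusted time coordinate is a timelike vector
  \<open>z\<close> orthogonal to both. Normalised, it lies in both walls, as its product with any
  other normal is at most 4 tau - a < 0.\<close>

lemma walls_intersect_if_adjacent:
  assumes x: "x \<in> set V96" and y: "y \<in> set V96" and adj: "adjacent x y"
  shows "walls_intersect (wall_normal x) (wall_normal y)"
proof -
  \<comment> \<open>The common value of (x + y) . x and (x + y) . y.\<close>
  define a where "a = 4 + 2 * tau"
  define z where "z = mkvec (a / sqrt (2 * tau)) (qval x + qval y)"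
  have inner: "qval x \<bullet> qval x = 4" "qval y \<bullet> qval y = 4" "qval x \<bullet> qval y = 2 * tau" "qval y \<bullet> qval x = 2 * tau"
    using gdot_self[OF x] gdot_self[OF y] adj
    by (simp_all add: gval_gdot[symmetric] adjacent_def inner_commute)
  have mink_z: "mink z (wall_normal k) = (qval x + qval y) \<bullet> qval k - a" for k
    using tau_bounds by (simp add: z_def wall_normal_def mink_mkvec)
  have "mink z z = 2 * a - a\<^sup>2 / (2 * tau)"
    using tau_bounds
    by (simp add: z_def mink_mkvec inner_add_left inner_add_right inner a_def power2_eq_square)
  also have "\<dots> = a * (tau - 2) / tau"
    using tau_bounds by (simp add: a_def field_simps power2_eq_square)
  also have "\<dots> < 0"
    using tau_bounds by (simp add: a_def divide_neg_pos mult_pos_neg)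
  finally have neg: "mink z z < 0" .
  define c where "c = 1 / sqrt (- mink z z)"
  have c: "c > 0" "c * c * mink z z = -1"
    using neg by (simp_all add: c_def field_simps)
  define v where "v = c *\<^sub>R z"
  have "z $ 0 > 0" using tau_bounds by (simp add: z_def mkvec_0 a_def)
  then have "v \<in> H4" using c by (simp add: H4_def v_def mink_scaleR)
  have le: "mink z (wall_normal k) \<le> 0" if k: "k \<in> set (V96 @ C24)" for k
  proof -
    have "qval x \<bullet> qval k + qval y \<bullet> qval k \<le> a"
    proof (cases "k = x \<or> k = y")
      case True
      then show ?thesis using inner by (auto simp: a_def)
    next
      case False
      then show ?thesis
        using inner_le_if_normals[OF x k] inner_le_if_normals[OF y k] tau_bounds
        by (simp add: inner_commute a_def)
    qed
    then show ?thesis by (simp add: mink_z inner_add_left)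
  qed
  have "normals120 \<subseteq> wall_normal ` set (V96 @ C24)"
    using normalsC_subset by (auto simp: normals120_def normals96_eq)
  then have "v \<in> P120"
    using \<open>v \<in> H4\<close> le c(1) by (auto simp: P120_def v_def mink_scaleR mult_le_0_iff)
  moreover have "mink v (wall_normal x) = 0" "mink v (wall_normal y) = 0"
    by (simp_all add: v_def mink_scaleR mink_z inner_add_left inner a_def)
  ultimately show ?thesis by (auto simp: walls_intersect_def wall_def)
qed

section \<open>Matrix exponential\<close>

lemma has_vector_derivative_vec:
  fixes f :: "real \<Rightarrow> ('a::real_normed_vector)^'n"
  assumes "\<And>i. ((\<lambda>t. f t $ i) has_vector_derivative D $ i) (at t)"
  shows "(f has_vector_derivative D) (at t)"
  unfolding has_vector_derivative_def has_derivative_at_within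
proof
  show "((\<lambda>y. (f y - f t - (y - t) *\<^sub>R D) /\<^sub>R norm (y - t)) \<longlongrightarrow> 0) (at t)"
  proof (rule vec_tendstoI)
    fix i
    show "((\<lambda>y. ((f y - f t - (y - t) *\<^sub>R D) /\<^sub>R norm (y - t)) $ i) \<longlongrightarrow> 0 $ i) (at t)"
      using assms[of i] unfolding has_vector_derivative_def has_derivative_at_within by simp
  qed
qed (rule bounded_linear_scaleR_left)

lemma bounded_bilinear_matrix_mult:
  "bounded_bilinear ((**) :: real^'m^'n \<Rightarrow> real^'k^'m \<Rightarrow> real^'k^'n)"
  unfolding bilinear_conv_bounded_bilinear[symmetric] bilinear_def
  by (auto intro!: linearI simp: matrix_matrix_mult_def vec_eq_iff algebra_simps sum.distrib sum_distrib_left)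

lemmas has_vector_derivative_matrix_mult =
  bounded_bilinear.has_vector_derivative[OF bounded_bilinear_matrix_mult]

lemmas matrix_mult_simps = bounded_bilinear.add_left[OF bounded_bilinear_matrix_mult]
  bounded_bilinear.add_right[OF bounded_bilinear_matrix_mult]
  bounded_bilinear.diff_left[OF bounded_bilinear_matrix_mult]
  bounded_bilinear.diff_right[OF bounded_bilinear_matrix_mult]
  bounded_bilinear.minus_left[OF bounded_bilinear_matrix_mult]
  bounded_bilinear.minus_right[OF bounded_bilinear_matrix_mult]
  bounded_bilinear.zero_left[OF bounded_bilinear_matrix_mult]
  bounded_bilinear.zero_right[OF bounded_bilinear_matrix_mult]

lemma bounded_linear_transpose: "bounded_linear (transpose :: real^'m^'n \<Rightarrow> real^'n^'m)"
  unfolding linear_conv_bounded_linear[symmetric]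
  by (auto intro!: linearI simp: transpose_def vec_eq_iff)

lemma const_if_vector_derivative_zero:
  fixes f :: "real \<Rightarrow> 'a::real_normed_vector"
  assumes "\<And>t. (f has_vector_derivative 0) (at t)"
  shows "f s = f t"
  by (rule has_derivative_zero_unique[of UNIV])
    (use assms in \<open>auto simp: has_vector_derivative_def\<close>)

section \<open>Power series of the exponential\<close>

fun mat_pow :: "real^'n^'n \<Rightarrow> nat \<Rightarrow> real^'n^'n" where
  "mat_pow X 0 = mat 1"
| "mat_pow X (Suc k) = X ** mat_pow X k"

lemma mat_pow_Suc_right: "mat_pow X (Suc k) = mat_pow X k ** X"
  by (induction k) (simp_all add: matrix_mul_assoc)

text \<open>The sum of all absolute entries bounds every row sum, so the entries of powers grow at
  most geometrically and the scalar exponential series dominates.\<close>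

lemma mat_pow_bound:
  "\<bar>mat_pow X k $ i $ j\<bar> \<le> (\<Sum>i\<in>UNIV. \<Sum>j\<in>UNIV. \<bar>X $ i $ j\<bar>) ^ k"
proof (induction k arbitrary: i j)
  case 0
  then show ?case by (simp add: mat_def)
next
  case (Suc k)
  let ?C = "\<Sum>i\<in>UNIV. \<Sum>j\<in>UNIV. \<bar>X $ i $ j\<bar>"
  have "\<bar>mat_pow X (Suc k) $ i $ j\<bar> \<le> (\<Sum>l\<in>UNIV. \<bar>X $ i $ l * mat_pow X k $ l $ j\<bar>)"
    by (simp add: matrix_matrix_mult_def)
  also have "\<dots> \<le> (\<Sum>l\<in>UNIV. \<bar>X $ i $ l\<bar> * ?C ^ k)"
    by (intro sum_mono) (simp add: abs_mult mult_left_mono Suc.IH)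
  also have "\<dots> = (\<Sum>l\<in>UNIV. \<bar>X $ i $ l\<bar>) * ?C ^ k" by (simp add: sum_distrib_right)
  also have "\<dots> \<le> ?C * ?C ^ k"
    by (intro mult_right_mono member_le_sum[of i UNIV "\<lambda>i. \<Sum>l\<in>UNIV. \<bar>X $ i $ l\<bar>"])
      (auto intro!: sum_nonneg zero_le_power)
  finally show ?case by simp
qed

text \<open>The exponential of t X, written entrywise so that real power series in t can be
  differentiated term by term.\<close>

definition mat_exp :: "real^'n^'n \<Rightarrow> real \<Rightarrow> real^'n^'n" where
  "mat_exp X t = (\<chi> i j. \<Sum>k. (mat_pow X k $ i $ j / fact k) * t ^ k)"

lemma summable_mat_exp: "summable (\<lambda>k. (mat_pow X k $ i $ j / fact k) * t ^ k)"
proof (rule summable_comparison_test)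
  let ?C = "\<Sum>i\<in>UNIV. \<Sum>j\<in>UNIV. \<bar>X $ i $ j\<bar>"
  show "summable (\<lambda>k. inverse (fact k) * (?C * \<bar>t\<bar>) ^ k)" by (rule summable_exp)
  have "norm ((mat_pow X k $ i $ j / fact k) * t ^ k) \<le> inverse (fact k) * (?C * \<bar>t\<bar>) ^ k" for k
  proof -
    have "norm ((mat_pow X k $ i $ j / fact k) * t ^ k) = inverse (fact k) * (\<bar>mat_pow X k $ i $ j\<bar> * \<bar>t\<bar> ^ k)"
      by (simp add: abs_mult power_abs divide_inverse)
    also have "\<dots> \<le> inverse (fact k) * (?C ^ k * \<bar>t\<bar> ^ k)"
      by (intro mult_left_mono mult_right_mono mat_pow_bound) auto
    finally show ?thesis by (simp add: power_mult_distrib)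
  qed
  then show "\<exists>N. \<forall>n\<ge>N. norm ((mat_pow X n $ i $ j / fact n) * t ^ n)
      \<le> inverse (fact n) * (?C * \<bar>t\<bar>) ^ n" by blast
qed

lemma suminf_diffs_mat_pow:
  "(\<Sum>k. diffs (\<lambda>k. mat_pow X k $ i $ j / fact k) k * t ^ k) =
    (\<Sum>k. (mat_pow X (Suc k) $ i $ j / fact k) * t ^ k)"
proof (rule suminf_cong)
  fix k
  have "real (Suc k) * (a / fact (Suc k)) = a / fact k" for a :: real
    by (simp del: of_nat_Suc)
  then show "diffs (\<lambda>k. mat_pow X k $ i $ j / fact k) k * t ^ k = (mat_pow X (Suc k) $ i $ j / fact k) * t ^ k"
    unfolding diffs_def by (simp del: mat_pow.simps fact_Suc)
qed

text \<open>Splitting X off the differentiated series on the left here, and on the right in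
  \<open>mat_exp_right\<close>, shows that X commutes with its exponential.\<close>

lemma mat_exp_left: "(\<Sum>k. (mat_pow X (Suc k) $ i $ j / fact k) * t ^ k) = (X ** mat_exp X t) $ i $ j"
proof -
  have "(\<Sum>k. (mat_pow X (Suc k) $ i $ j / fact k) * t ^ k) =
      (\<Sum>k. \<Sum>l\<in>UNIV. X $ i $ l * ((mat_pow X k $ l $ j / fact k) * t ^ k))"
    by (simp add: matrix_matrix_mult_def sum_divide_distrib sum_distrib_right mult.assoc)
  also have "\<dots> = (\<Sum>l\<in>UNIV. \<Sum>k. X $ i $ l * ((mat_pow X k $ l $ j / fact k) * t ^ k))"
    by (intro suminf_sum summable_mult summable_mat_exp)
  also have "\<dots> = (\<Sum>l\<in>UNIV. X $ i $ l * (\<Sum>k. (mat_pow X k $ l $ j / fact k) * t ^ k))"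
    by (intro sum.cong refl suminf_mult summable_mat_exp)
  finally show ?thesis by (simp add: matrix_matrix_mult_def mat_exp_def)
qed

lemma mat_exp_right: "(\<Sum>k. (mat_pow X (Suc k) $ i $ j / fact k) * t ^ k) = (mat_exp X t ** X) $ i $ j"
proof -
  have "(\<Sum>k. (mat_pow X (Suc k) $ i $ j / fact k) * t ^ k) =
      (\<Sum>k. \<Sum>l\<in>UNIV. X $ l $ j * ((mat_pow X k $ i $ l / fact k) * t ^ k))"
    unfolding mat_pow_Suc_right
    by (simp add: matrix_matrix_mult_def sum_divide_distrib sum_distrib_right sum_distrib_left mult_ac)
  also have "\<dots> = (\<Sum>l\<in>UNIV. \<Sum>k. X $ l $ j * ((mat_pow X k $ i $ l / fact k) * t ^ k))"
    by (intro suminf_sum summable_mult summable_mat_exp)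
  also have "\<dots> = (\<Sum>l\<in>UNIV. X $ l $ j * (\<Sum>k. (mat_pow X k $ i $ l / fact k) * t ^ k))"
    by (intro sum.cong refl suminf_mult summable_mat_exp)
  finally show ?thesis by (simp add: matrix_matrix_mult_def mat_exp_def mult.commute)
qed

lemma mat_exp_commute: "mat_exp X t ** X = X ** mat_exp X t"
  by (simp add: vec_eq_iff mat_exp_left[symmetric] mat_exp_right[symmetric])

lemma mat_exp_0 [simp]: "mat_exp X 0 = mat 1"
  by (simp only: mat_exp_def vec_eq_iff vec_lambda_beta powser_zero) simp

lemma has_vector_derivative_mat_exp:
  "(mat_exp X has_vector_derivative X ** mat_exp X t) (at t)"
proof (rule has_vector_derivative_vec, rule has_vector_derivative_vec)
  fix i j
  have "((\<lambda>t. \<Sum>k. (mat_pow X k $ i $ j / fact k) * t ^ k) has_field_derivative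
      (\<Sum>k. diffs (\<lambda>k. mat_pow X k $ i $ j / fact k) k * t ^ k)) (at t)"
    by (rule termdiffs_strong_converges_everywhere) (rule summable_mat_exp)
  then show "((\<lambda>t. mat_exp X t $ i $ j) has_vector_derivative (X ** mat_exp X t) $ i $ j) (at t)"
    unfolding suminf_diffs_mat_pow mat_exp_left
    by (simp add: mat_exp_def has_real_derivative_iff_has_vector_derivative)
qed

lemma has_vector_derivative_mat_exp_minus:
  "((\<lambda>t. mat_exp X (- t)) has_vector_derivative - (X ** mat_exp X (- t))) (at t)"
proof -
  have "((\<lambda>t. - t) has_vector_derivative (-1 :: real)) (at t)"
    by (auto intro!: derivative_eq_intros)
  then show ?thesis
    using vector_diff_chain_at[of uminus "-1" t "mat_exp X" "X ** mat_exp X (- t)"]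
      has_vector_derivative_mat_exp[of X "- t"]
    by (simp add: comp_def)
qed

text \<open>The product has derivative 0, because X commutes with \<open>mat_exp X t\<close>, and is
  the identity at t = 0.\<close>

lemma mat_exp_inverse: "mat_exp X t ** mat_exp X (- t) = mat 1"
proof -
  have "((\<lambda>t. mat_exp X t ** mat_exp X (- t)) has_vector_derivative
      mat_exp X t ** - (X ** mat_exp X (- t)) + (X ** mat_exp X t) ** mat_exp X (- t)) (at t)" for t
    by (intro has_vector_derivative_matrix_mult has_vector_derivative_mat_exp
        has_vector_derivative_mat_exp_minus)
  moreover have "mat_exp X t ** - (X ** mat_exp X (- t)) + (X ** mat_exp X t) ** mat_exp X (- t) = 0" for t
    by (simp add: matrix_mult_simps matrix_mul_assoc mat_exp_commute)
  ultimately have "mat_exp X t ** mat_exp X (- t) = mat_exp X 0 ** mat_exp X (- 0)"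
    by (intro const_if_vector_derivative_zero[of "\<lambda>t. mat_exp X t ** mat_exp X (- t)"]) simp
  then show ?thesis by simp
qed

lemma mat_exp_inverse': "mat_exp X (- t) ** mat_exp X t = mat 1"
  using mat_exp_inverse[of X "- t"] by simp

lemma matrix_inv_mat_exp: "matrix_inv (mat_exp X t) = mat_exp X (- t)"
  unfolding matrix_inv_def
proof (rule some_equality)
  fix B assume "mat_exp X t ** B = mat 1 \<and> B ** mat_exp X t = mat 1"
  then have "B ** mat_exp X t ** mat_exp X (- t) = mat_exp X (- t)" by simp
  then show "B = mat_exp X (- t)" by (simp add: matrix_mul_assoc[symmetric] mat_exp_inverse)
qed (simp add: mat_exp_inverse mat_exp_inverse')

text \<open>The hypothesis puts X in the Lie algebra of O(1,4): with E = exp (t X), the derivative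
  of E^T M E is E^T (X^T M + M X) E = 0.\<close>

lemma mat_exp_in_O14:
  assumes "transpose X ** Mmat + Mmat ** X = 0"
  shows "mat_exp X t \<in> O14"
proof -
  let ?f = "\<lambda>t. transpose (mat_exp X t) ** (Mmat ** mat_exp X t)"
  have "(?f has_vector_derivative
      transpose (mat_exp X t) ** (Mmat ** (X ** mat_exp X t) + 0 ** mat_exp X t)
        + transpose (X ** mat_exp X t) ** (Mmat ** mat_exp X t)) (at t)" for t
    by (intro has_vector_derivative_matrix_mult has_vector_derivative_const
        bounded_linear.has_vector_derivative[OF bounded_linear_transpose] has_vector_derivative_mat_exp)
  moreover have "transpose (mat_exp X t) ** (Mmat ** (X ** mat_exp X t) + 0 ** mat_exp X t)
        + transpose (X ** mat_exp X t) ** (Mmat ** mat_exp X t)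
      = transpose (mat_exp X t) ** (transpose X ** Mmat + Mmat ** X) ** mat_exp X t" for t
    by (simp add: matrix_mult_simps matrix_transpose_mul matrix_mul_assoc)
  ultimately have "?f t = ?f 0"
    using assms by (intro const_if_vector_derivative_zero[of ?f]) (simp add: matrix_mult_simps)
  then show ?thesis by (simp add: O14_def matrix_mul_assoc)
qed

section \<open>Conjugation paths\<close>

definition conj_path :: "real^'n^'n \<Rightarrow> real^'n^'n \<Rightarrow> real \<Rightarrow> real^'n^'n" where
  "conj_path X R t = mat_exp X t ** R ** mat_exp X (- t)"

lemma has_vector_derivative_conj_path:
  "(conj_path X R has_vector_derivative conj_path X (X ** R - R ** X) t) (at t)"
proof -
  have "(conj_path X R has_vector_derivative
      (mat_exp X t ** R) ** - (X ** mat_exp X (- t)) +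
      (mat_exp X t ** 0 + (X ** mat_exp X t) ** R) ** mat_exp X (- t)) (at t)"
    unfolding conj_path_def[abs_def]
    by (intro has_vector_derivative_matrix_mult has_vector_derivative_mat_exp
        has_vector_derivative_mat_exp_minus has_vector_derivative_const)
  also have "(mat_exp X t ** R) ** - (X ** mat_exp X (- t)) +
      (mat_exp X t ** 0 + (X ** mat_exp X t) ** R) ** mat_exp X (- t)
      = conj_path X (X ** R - R ** X) t"
    unfolding conj_path_def mat_exp_commute[of X t, symmetric]
    by (simp add: matrix_mult_simps matrix_mul_assoc)
  finally show ?thesis .
qed

text \<open>Each derivative is again a conjugation path, with \<open>R\<close> replaced by an
  iterated commutator with \<open>X\<close>.\<close>

lemma smooth_on_conj_path: "smooth_on S (conj_path X R)"
proof -
  define D where "D k = conj_path X (((\<lambda>A. X ** A - A ** X) ^^ k) R)" for k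
  have "(D k has_vector_derivative D (Suc k) t) (at t)" for k t
    unfolding D_def by (simp add: has_vector_derivative_conj_path)
  then show ?thesis unfolding smooth_on_def by (intro exI[of _ D]) (simp add: D_def)
qed

section \<open>Deformations of reflections\<close>

lemma mink_Mmat: "mink x y = x \<bullet> (Mmat *v y)"
  by (simp add: mink_def inner_vec_def matrix_vector_mult_def Mmat_def sum_5 distinct_5
      if_distrib[of "\<lambda>a. a * _"] cong: if_cong)

lemma inner_vector_matrix: "x \<bullet> (y v* A) = (A *v x) \<bullet> (y :: real^'n)"
  by (metis dot_lmul_matrix inner_commute)

lemma matrix_vector_mult_uminus: "A *v (- x) = - (A *v (x :: real^'n))"
  by (simp add: vec_eq_iff matrix_vector_mult_def sum_negf)

lemma matrix_eq_if_inner_eq: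
  fixes A B :: "real^'n^'m"
  assumes "\<And>x y. x \<bullet> (A *v y) = x \<bullet> (B *v y)"
  shows "A = B"
  unfolding matrix_eq using assms by (metis vector_eq_ldot)

lemma O14_iff: "A \<in> O14 \<longleftrightarrow> (\<forall>x y. mink (A *v x) (A *v y) = mink x y)"
proof -
  have "mink (A *v x) (A *v y) = x \<bullet> ((transpose A ** Mmat ** A) *v y)" for x y
    by (simp add: mink_Mmat inner_vector_matrix matrix_vector_mul_assoc[symmetric])
  then show ?thesis
    unfolding O14_def using matrix_eq_if_inner_eq[of "transpose A ** Mmat ** A" Mmat]
    by (auto simp: mink_Mmat)
qed

lemma mink_eq_spatial: "mink x y = spatial x \<bullet> spatial y - x $ 0 * y $ 0"
  by (simp add: mink_def spatial_def)

text \<open>Spatial norms are bounded by absolute time coordinates, so by Cauchy-Schwarz a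
  \<open>y\<close> of nonpositive time would have product at least 0 with \<open>x\<close>.\<close>

lemma future_if_mink_neg:
  assumes "x \<in> H4" "mink y y = -1" "mink x y < 0"
  shows "y \<in> H4"
proof (rule ccontr)
  assume "y \<notin> H4"
  then have y: "y $ 0 \<le> 0" using assms(2) by (auto simp: H4_def)
  have x: "x $ 0 > 0" "mink x x = -1" using assms(1) by (auto simp: H4_def)
  have "norm (spatial x) ^ 2 \<le> (x $ 0)\<^sup>2" "norm (spatial y) ^ 2 \<le> (y $ 0)\<^sup>2"
    using x(2) assms(2) unfolding mink_eq_spatial power2_norm_eq_inner power2_eq_square[of "_ $ 0"]
    by linarith+
  then have "norm (spatial x) \<le> x $ 0" "norm (spatial y) \<le> - y $ 0"
    using x(1) y power2_le_imp_le[of "norm (spatial x)" "x $ 0"]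
      power2_le_imp_le[of "norm (spatial y)" "- y $ 0"] by simp_all
  then have "norm (spatial x) * norm (spatial y) \<le> x $ 0 * - y $ 0"
    using x(1) by (intro mult_mono) auto
  moreover have "- (spatial x \<bullet> spatial y) \<le> norm (spatial x) * norm (spatial y)"
    using Cauchy_Schwarz_ineq2[of "spatial x" "spatial y"] by linarith
  ultimately show False using assms(3) by (simp add: mink_eq_spatial)
qed

lemma nonzero_time_if_mink_neg:
  assumes "mink y y = -1"
  shows "y $ 0 \<noteq> 0"
proof
  assume "y $ 0 = 0"
  then have "spatial y \<bullet> spatial y = -1" using assms by (simp add: mink_eq_spatial)
  then show False using inner_ge_zero[of "spatial y"] by linarith
qed

text \<open>The reflection formula gives an element of \<open>G4\<close> as described in
  \<open>refl_mat\<close>; it is the only one because \<open>n\<close> and its orthogonal complement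
  span the space.\<close>

lemma refl_mat_mult:
  assumes "mink n n > 0"
  shows "refl_mat n *v x = x - (2 * mink x n / mink n n) *\<^sub>R n"
proof -
  define q where "q = mink n n"
  define f where "f x = x - (2 * mink x n / q) *\<^sub>R n" for x
  have q: "q > 0" using assms by (simp add: q_def)
  have "linear f"
    by (intro linearI) (simp_all add: f_def mink_add mink_scaleR algebra_simps add_divide_distrib)
  define A where "A = matrix f"
  have A: "A *v x = f x" for x using \<open>linear f\<close> by (simp add: A_def matrix_works)
  have pres: "mink (f x) (f y) = mink x y" for x y
  proof -
    define a b where "a = 2 * mink x n / q" and "b = 2 * mink y n / q"
    have "a * mink y n = b * mink x n" "a * (b * q) = 2 * (a * mink y n)"
      using q by (simp_all add: a_def b_def)
    moreover have "mink (f x) (f y) = mink x y - b * mink x n - a * mink y n + a * (b * q)"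
      unfolding f_def a_def[symmetric] b_def[symmetric]
      by (simp only: mink_diff mink_scaleR mink_commute[of n y] q_def[symmetric]) (simp add: algebra_simps)
    ultimately show ?thesis by simp
  qed
  have "A \<in> G4"
    unfolding G4_def
  proof (intro CollectI conjI ballI)
    show "A \<in> O14" using pres by (simp add: O14_iff A)
    fix x assume x: "x \<in> H4"
    show "A *v x \<in> H4"
    proof (rule future_if_mink_neg[OF x])
      show "mink (A *v x) (A *v x) = -1" using x by (simp add: A pres H4_def)
      \<comment> \<open>The product of x with its image is at most -1, which keeps the image on the
        same sheet.\<close>
      have "mink x (A *v x) = -1 - 2 * (mink x n)\<^sup>2 / q"
        using x by (simp add: A f_def mink_diff mink_scaleR H4_def power2_eq_square)
      moreover have "2 * (mink x n)\<^sup>2 / q \<ge> 0" using q by simp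
      ultimately show "mink x (A *v x) < 0" by linarith
    qed
  qed
  moreover have "\<forall>x. mink x n = 0 \<longrightarrow> A *v x = x" by (simp add: A f_def)
  moreover have "A *v n = - n" using q by (simp add: A f_def q_def[symmetric] scaleR_2)
  moreover have "B = A" if "\<forall>x. mink x n = 0 \<longrightarrow> B *v x = x" "B *v n = - n" for B
  proof -
    have "B *v x = A *v x" for x
    proof -
      define c where "c = mink x n / q"
      have "mink (x - c *\<^sub>R n) n = 0" using q by (simp add: c_def mink_diff mink_scaleR q_def[symmetric])
      then have "B *v (x - c *\<^sub>R n) = x - c *\<^sub>R n" using that by blast
      then have "B *v x = x - c *\<^sub>R n - c *\<^sub>R n"
        using that(2) by (simp add: matrix_vector_mult_diff_distrib matrix_vector_mult_scaleR algebra_simps)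
      then show ?thesis
        by (simp add: A f_def c_def algebra_simps scaleR_2[symmetric])
    qed
    then show ?thesis by (simp add: matrix_eq)
  qed
  ultimately have "refl_mat n = A" unfolding refl_mat_def by (intro the_equality) blast+
  then show ?thesis by (simp add: A f_def q_def)
qed

text \<open>Along the path from the identity, the time coordinate of the image of a point of
  \<open>H4\<close> never vanishes, so by connectedness it stays positive.\<close>

lemma mat_exp_in_G4:
  assumes "transpose X ** Mmat + Mmat ** X = 0"
  shows "mat_exp X t \<in> G4"
  unfolding G4_def
proof (intro CollectI conjI ballI)
  show "mat_exp X t \<in> O14" using assms by (rule mat_exp_in_O14)
  fix x assume x: "x \<in> H4"
  define f where "f t = (mat_exp X t *v x) $ 0" for t
  have mink: "mink (mat_exp X t *v x) (mat_exp X t *v x) = -1" for t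
    using mat_exp_in_O14[OF assms] x by (simp add: O14_iff H4_def)
  have "continuous_on UNIV (mat_exp X)"
    by (auto simp: continuous_on_eq_continuous_at
        intro: has_vector_derivative_continuous has_vector_derivative_mat_exp)
  then have "continuous_on UNIV f"
    unfolding f_def matrix_vector_mult_def by (auto intro!: continuous_intros)
  then have "connected (range f)" by (intro connected_continuous_image) auto
  moreover have "f 0 > 0" using x by (simp add: f_def H4_def)
  moreover have "0 \<notin> range f" using nonzero_time_if_mink_neg[OF mink] by (auto simp: f_def)
  ultimately have "f t > 0"
    using connectedD_interval[of "range f" "f t" "f 0" 0] by (meson less_imp_le not_le rangeI)
  then show "mat_exp X t *v x \<in> H4" using mink by (simp add: H4_def f_def)
qed

text \<open>\<open>w\<close> is the velocity of the normal: differentiating R n = -n with w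
  orthogonal to n gives A n = -2 w. The involution equation maps the complement of n to multiples of
  n, and the form equation finds the multiple.\<close>

lemma refl_deformation:
  assumes q: "mink n n > 0"
    and form: "transpose (refl_mat n) ** Mmat ** A + transpose A ** Mmat ** refl_mat n = 0"
    and invol: "refl_mat n ** A + A ** refl_mat n = 0"
    and w: "w = (- 1 / 2) *\<^sub>R (A *v n)"
  shows "mink w n = 0"
    and "A *v x = (- 2 / mink n n) *\<^sub>R (mink x w *\<^sub>R n + mink x n *\<^sub>R w)"
proof -
  define R where "R = refl_mat n"
  define q where "q = mink n n"
  have q: "q > 0" "n \<noteq> 0" using assms(1) by (auto simp: q_def mink_def)
  have R: "R *v x = x - (2 * mink x n / q) *\<^sub>R n" for x
    using refl_mat_mult[OF assms(1)] by (simp add: R_def q_def)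
  have Rn: "R *v n = - n" using q by (simp add: R q_def[symmetric] scaleR_2)
  have form': "mink (R *v x) (A *v y) + mink (A *v x) (R *v y) = 0" for x y
  proof -
    have "mink (R *v x) (A *v y) + mink (A *v x) (R *v y) =
        x \<bullet> ((transpose R ** Mmat ** A + transpose A ** Mmat ** R) *v y)"
      by (simp add: mink_Mmat inner_vector_matrix matrix_vector_mul_assoc[symmetric]
          matrix_vector_mult_add_rdistrib inner_add_right)
    then show ?thesis using form by (simp add: R_def)
  qed
  have invol': "R *v (A *v x) + A *v (R *v x) = 0" for x
  proof -
    have "R *v (A *v x) + A *v (R *v x) = (R ** A + A ** R) *v x"
      by (simp add: matrix_vector_mul_assoc matrix_vector_mult_add_rdistrib)
    then show ?thesis using invol by (simp add: R_def)
  qed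
  have An: "A *v n = - 2 *\<^sub>R w" by (simp add: w)
  have "R *v (A *v n) = A *v n"
    using invol'[of n] by (simp add: Rn matrix_vector_mult_uminus algebra_simps)
  then have "mink (A *v n) n = 0" using q by (simp add: R)
  then show wn: "mink w n = 0" by (simp add: w mink_scaleR mink_minus)
  have perp: "A *v x = (- 2 / q * mink x w) *\<^sub>R n" if "mink x n = 0" for x
  proof -
    have Rx: "R *v x = x" using that by (simp add: R)
    have "R *v (A *v x) + A *v x = 0" using invol'[of x] by (simp add: Rx)
    then have "2 *\<^sub>R (A *v x) = (2 * mink (A *v x) n / q) *\<^sub>R n"
      unfolding R[of "A *v x"] by (simp add: scaleR_2 algebra_simps)
    then have "(1 / 2) *\<^sub>R 2 *\<^sub>R (A *v x) = (1 / 2) *\<^sub>R (2 * mink (A *v x) n / q) *\<^sub>R n" by simp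
    then have "A *v x = (mink (A *v x) n / q) *\<^sub>R n" by simp
    moreover have "mink (A *v x) n = - 2 * mink x w"
      using form'[of x n] by (simp add: Rx Rn An mink_minus mink_scaleR)
    ultimately show ?thesis by simp
  qed
  define c where "c = mink x n / q"
  have "mink (x - c *\<^sub>R n) n = 0" using q by (simp add: c_def mink_diff mink_scaleR q_def[symmetric])
  then have "A *v (x - c *\<^sub>R n) = (- 2 / q * mink (x - c *\<^sub>R n) w) *\<^sub>R n" by (rule perp)
  moreover have "mink (x - c *\<^sub>R n) w = mink x w"
    using wn by (simp add: mink_diff mink_scaleR mink_commute[of n w])
  ultimately have "A *v x = (- 2 / q * mink x w) *\<^sub>R n + c *\<^sub>R (A *v n)"
    by (simp add: matrix_vector_mult_diff_distrib matrix_vector_mult_scaleR algebra_simps)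
  then show "A *v x = (- 2 / mink n n) *\<^sub>R (mink x w *\<^sub>R n + mink x n *\<^sub>R w)"
    by (simp add: An c_def q_def[symmetric] scaleR_add_right)
qed

text \<open>Let z be the derivative of RS applied to n. The relation at n says that RS fixes z,
  while RS negates the product with m. Hence z is orthogonal to m, which is the claim up to a factor
  -2.\<close>

lemma commuting_refl_deformation:
  assumes q: "mink n n > 0" "mink m m > 0" and orth: "mink n m = 0"
    and A: "A *v n = - 2 *\<^sub>R w"
    and B: "B *v n = (- 2 / mink m m) *\<^sub>R (mink n w' *\<^sub>R m + mink n m *\<^sub>R w')"
    and rel: "(refl_mat n ** refl_mat m) ** (refl_mat n ** B + A ** refl_mat m)
      + (refl_mat n ** B + A ** refl_mat m) ** (refl_mat n ** refl_mat m) = 0"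
  shows "mink w m + mink n w' = 0"
proof -
  define R S where "R = refl_mat n" and "S = refl_mat m"
  note R = refl_mat_mult[OF q(1), folded R_def] and S = refl_mat_mult[OF q(2), folded S_def]
  have Sn: "S *v n = n" and Rm: "R *v m = m" and Rn: "R *v n = - n"
    using orth q by (simp_all add: R S mink_commute[of m n] scaleR_2)
  define z where "z = (R ** B + A ** S) *v n"
  have z: "z = (- 2 / mink m m * mink n w') *\<^sub>R m - 2 *\<^sub>R w"
    using A B
    by (simp add: z_def matrix_vector_mult_add_rdistrib matrix_vector_mul_assoc[symmetric] Sn orth
        matrix_vector_mult_scaleR matrix_vector_mult_uminus Rm)
  have "((R ** S) ** (R ** B + A ** S) + (R ** B + A ** S) ** (R ** S)) *v n = 0"
    using rel by (simp add: R_def S_def)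
  then have "R *v (S *v z) + (R ** B + A ** S) *v (R *v (S *v n)) = 0"
    by (simp add: z_def matrix_vector_mult_add_rdistrib[of "(R ** S) ** (R ** B + A ** S)"]
        matrix_vector_mul_assoc[symmetric])
  then have "R *v (S *v z) = z"
    by (simp add: Sn Rn matrix_vector_mult_uminus z_def[symmetric])
  moreover have "mink (R *v (S *v z)) m = - mink z m"
    using orth q by (simp add: R S mink_diff mink_scaleR)
  ultimately have "mink z m = 0" by simp
  then show ?thesis using q by (simp add: z mink_diff mink_scaleR mink_minus mink_commute[of n w'])
qed

section \<open>Linearised relations for the 96 reflections\<close>

lemma mink_pos_if_normals96:
  assumes "n \<in> normals96"
  shows "mink n n > 0"
proof -
  obtain x where "x \<in> set V96" "n = wall_normal x" using assms unfolding normals96_eq by blast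
  then show ?thesis
    using gdot_self[of x] tau_bounds by (simp add: mink_wall_normal gval_gdot[symmetric])
qed

text \<open>The product rule computes the derivative of each relation along the path; uniqueness of
  derivatives equates it with 0.\<close>

lemma inf_deformation_refl:
  assumes "inf_deformation refl_mat v"
  obtains w where "\<And>n. n \<in> normals96 \<Longrightarrow> mink (w n) n = 0"
    "\<And>n x. n \<in> normals96 \<Longrightarrow>
      v n *v x = (- 2 / mink n n) *\<^sub>R (mink x (w n) *\<^sub>R n + mink x n *\<^sub>R w n)"
    "\<And>n m. n \<in> normals96 \<Longrightarrow> m \<in> normals96 \<Longrightarrow> mink n m = 0 \<Longrightarrow> walls_intersect n m \<Longrightarrow>
      mink (w n) m + mink n (w m) = 0"
proof -
  obtain p where p0: "\<And>n. n \<in> normals96 \<Longrightarrow> p 0 n = refl_mat n"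
    and p': "\<And>n. n \<in> normals96 \<Longrightarrow> ((\<lambda>t. p t n) has_vector_derivative v n) (at 0)"
    and form: "\<And>n. n \<in> normals96 \<Longrightarrow>
      ((\<lambda>t. transpose (p t n) ** Mmat ** p t n - Mmat) has_vector_derivative 0) (at 0)"
    and invol: "\<And>n. n \<in> normals96 \<Longrightarrow> ((\<lambda>t. p t n ** p t n - mat 1) has_vector_derivative 0) (at 0)"
    and rel: "\<And>n m. n \<in> normals96 \<Longrightarrow> m \<in> normals96 \<Longrightarrow> n \<noteq> m \<Longrightarrow> walls_intersect n m \<Longrightarrow>
      ((\<lambda>t. (p t n ** p t m) ** (p t n ** p t m) - mat 1) has_vector_derivative 0) (at 0)"
    using assms unfolding inf_deformation_def by blast
  note q = mink_pos_if_normals96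
  define w where "w n = (- 1 / 2) *\<^sub>R (v n *v n)" for n
  have form': "transpose (refl_mat n) ** Mmat ** v n + transpose (v n) ** Mmat ** refl_mat n = 0"
    if n: "n \<in> normals96" for n
  proof -
    have "((\<lambda>t. transpose (p t n) ** Mmat ** p t n - Mmat) has_vector_derivative
        (transpose (p 0 n) ** Mmat ** v n + (transpose (p 0 n) ** 0 + transpose (v n) ** Mmat) ** p 0 n) - 0) (at 0)"
      using p'[OF n]
      by (intro has_vector_derivative_diff has_vector_derivative_matrix_mult has_vector_derivative_const
          bounded_linear.has_vector_derivative[OF bounded_linear_transpose])
    from vector_derivative_unique_at[OF this form[OF n]] show ?thesis
      by (simp add: p0[OF n] matrix_mult_simps)
  qed
  have invol': "refl_mat n ** v n + v n ** refl_mat n = 0" if n: "n \<in> normals96" for n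
  proof -
    have "((\<lambda>t. p t n ** p t n - mat 1) has_vector_derivative (p 0 n ** v n + v n ** p 0 n) - 0) (at 0)"
      using p'[OF n]
      by (intro has_vector_derivative_diff has_vector_derivative_matrix_mult has_vector_derivative_const)
    from vector_derivative_unique_at[OF this invol[OF n]] show ?thesis by (simp add: p0[OF n])
  qed
  have perp: "mink (w n) n = 0"
    and v: "v n *v x = (- 2 / mink n n) *\<^sub>R (mink x (w n) *\<^sub>R n + mink x n *\<^sub>R w n)"
    if n: "n \<in> normals96" for n x
    using refl_deformation[OF q[OF n] form'[OF n] invol'[OF n] w_def] by blast+
  have "mink (w n) m + mink n (w m) = 0"
    if n: "n \<in> normals96" and m: "m \<in> normals96" and orth: "mink n m = 0" and "walls_intersect n m" for n m
  proof (rule commuting_refl_deformation[OF q[OF n] q[OF m] orth])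
    show "v n *v n = - 2 *\<^sub>R w n" by (simp add: w_def)
    show "v m *v n = (- 2 / mink m m) *\<^sub>R (mink n (w m) *\<^sub>R m + mink n m *\<^sub>R w m)" using v[OF m] .
    have "n \<noteq> m" using orth q[OF n] by auto
    have "((\<lambda>t. (p t n ** p t m) ** (p t n ** p t m) - mat 1) has_vector_derivative
        ((p 0 n ** p 0 m) ** (p 0 n ** v m + v n ** p 0 m)
          + (p 0 n ** v m + v n ** p 0 m) ** (p 0 n ** p 0 m)) - 0) (at 0)"
      using p'[OF n] p'[OF m]
      by (intro has_vector_derivative_diff has_vector_derivative_matrix_mult has_vector_derivative_const)
    from vector_derivative_unique_at[OF this rel[OF n m \<open>n \<noteq> m\<close> \<open>walls_intersect n m\<close>]]
    show "(refl_mat n ** refl_mat m) ** (refl_mat n ** v m + v n ** refl_mat m)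
        + (refl_mat n ** v m + v n ** refl_mat m) ** (refl_mat n ** refl_mat m) = 0"
      by (simp add: p0[OF n] p0[OF m])
  qed
  with perp v show ?thesis by (rule that)
qed

text \<open>The path exp (t X) \<rho> exp (-t X) stays in the orbit and has the commutator as its
  initial velocity.\<close>

lemma inf_conjugation_commutator:
  assumes X: "transpose X ** Mmat + Mmat ** X = 0"
    and v: "\<And>n. n \<in> normals96 \<Longrightarrow> v n = X ** \<rho> n - \<rho> n ** X"
  shows "inf_conjugation \<rho> v"
  unfolding inf_conjugation_def
proof (intro exI[of _ "1 :: real"] exI[of _ "\<lambda>t n. conj_path X (\<rho> n) t"] conjI ballI)
  show "smooth_path 1 (\<lambda>t n. conj_path X (\<rho> n) t)"
    by (simp add: smooth_path_def smooth_on_conj_path)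
next
  fix n assume "n \<in> normals96"
  then show "((\<lambda>t. conj_path X (\<rho> n) t) has_vector_derivative v n) (at 0)"
    using has_vector_derivative_conj_path[of X "\<rho> n" 0] by (simp add: v conj_path_def[of X _ 0])
next
  fix t
  show "\<exists>g\<in>G4. \<forall>n\<in>normals96. conj_path X (\<rho> n) t = g ** \<rho> n ** matrix_inv g"
    by (intro bexI[of _ "mat_exp X t"] ballI)
      (simp_all add: conj_path_def matrix_inv_mat_exp mat_exp_in_G4[OF X])
qed (simp_all add: conj_path_def)

text \<open>Since (X x, n) = -(x, X n), the commutator with the reflection is its first-order change
  when the normal moves by X n.\<close>

lemma skew_deformation_is_commutator:
  assumes q: "mink n n > 0"
    and skew: "\<And>x y. mink (X *v x) y = - mink x (X *v y)"
    and A: "\<And>x. A *v x = (- 2 / mink n n) *\<^sub>R (mink x (X *v n) *\<^sub>R n + mink x n *\<^sub>R (X *v n))"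
  shows "A = X ** refl_mat n - refl_mat n ** X"
proof -
  have "A *v x = (X ** refl_mat n - refl_mat n ** X) *v x" for x
    by (simp add: A refl_mat_mult[OF q] matrix_vector_mult_diff_rdistrib matrix_vector_mul_assoc[symmetric]
        matrix_vector_mult_diff_distrib matrix_vector_mult_scaleR skew algebra_simps)
  then show ?thesis by (simp add: matrix_eq)
qed

theorem theorem4p1:
  shows "inf_rigid refl_mat"
  unfolding inf_rigid_def
proof (intro allI impI)
  fix v assume "inf_deformation refl_mat v"
  then obtain w where perp: "\<And>n. n \<in> normals96 \<Longrightarrow> mink (w n) n = 0"
    and v: "\<And>n x. n \<in> normals96 \<Longrightarrow>
      v n *v x = (- 2 / mink n n) *\<^sub>R (mink x (w n) *\<^sub>R n + mink x n *\<^sub>R w n)"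
    and pair: "\<And>n m. n \<in> normals96 \<Longrightarrow> m \<in> normals96 \<Longrightarrow> mink n m = 0 \<Longrightarrow> walls_intersect n m \<Longrightarrow>
      mink (w n) m + mink n (w m) = 0"
    by (rule inf_deformation_refl) blast
  define s where "s = sqrt (2 * tau)"
  have s: "s > 0" using tau_bounds by (simp add: s_def)
  define u where "u x = spatial (w (wall_normal x))" for x
  have normal: "wall_normal x \<in> normals96" if "x \<in> set V96" for x using that by (simp add: normals96_eq)
  have mink_w: "mink (w n) (wall_normal y) = spatial (w n) \<bullet> qval y - w n $ 0 * s" for n y
    by (simp add: mink_eq_spatial wall_normal_def mkvec_0 s_def)
  \<comment> \<open>Orthogonality of \<open>w n\<close> to \<open>n\<close> determines its time
    component from its spatial part.\<close>
  have time: "w (wall_normal x) $ 0 * s = u x \<bullet> qval x" if "x \<in> set V96" for x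
    using perp[OF normal[OF that]] by (simp add: mink_w u_def)
  have "motion u"
    unfolding motion_def
  proof (intro ballI impI)
    fix x y assume x: "x \<in> set V96" and y: "y \<in> set V96" and adj: "adjacent x y"
    have "mink (wall_normal x) (wall_normal y) = 0"
      using adj by (simp add: mink_wall_normal gval_gdot[symmetric] adjacent_def)
    then have "mink (w (wall_normal x)) (wall_normal y) + mink (wall_normal x) (w (wall_normal y)) = 0"
      using pair[OF normal[OF x] normal[OF y]] walls_intersect_if_adjacent[OF x y adj] by blast
    \<comment> \<open>Eliminating the time components turns the commutation relation into the bar
      equation of \<open>u\<close>.\<close>
    then have "u x \<bullet> qval y - u x \<bullet> qval x + (u y \<bullet> qval x - u y \<bullet> qval y) = 0"
      unfolding mink_commute[of "wall_normal x"] mink_w time[OF x] time[OF y] by (simp add: u_def)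
    then show "rigid_pair u x y" by (simp add: rigid_pair_def algebra_simps)
  qed
  then obtain b W where W: "linear W" "\<And>x y. x \<bullet> W y = - (W x \<bullet> y)"
    and u: "\<And>x. x \<in> set V96 \<Longrightarrow> u x = b + W (qval x)"
    by (rule motion_is_infinitesimal_isometry) blast
  \<comment> \<open>The Lorentz algebra element with rotation \<open>W\<close> and boost
    \<open>b / s\<close>. Normals have time coordinate s, so its spatial part there is the affine
    field b + W x.\<close>
  define f where "f x = mkvec ((b \<bullet> spatial x) / s) ((x $ 0 / s) *\<^sub>R b + W (spatial x))" for x
  have spatial_linear: "spatial (x + y) = spatial x + spatial y" "spatial (c *\<^sub>R x) = c *\<^sub>R spatial x" for x y c
    by (simp_all add: spatial_def)
  have eqI: "x = y" if "x $ 0 = y $ 0" "spatial x = spatial y" for x y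
    using that mkvec_spatial[of x] mkvec_spatial[of y] by metis
  have "linear f"
    by (intro linearI eqI)
      (simp_all add: f_def mkvec_0 spatial_linear linear_add[OF W(1)] linear_scale[OF W(1)]
        inner_add_right add_divide_distrib algebra_simps)
  define X where "X = matrix f"
  have X: "X *v x = f x" for x using \<open>linear f\<close> by (simp add: X_def matrix_works)
  have skew: "mink (X *v x) y = - mink x (X *v y)" for x y
    unfolding X f_def mink_eq_spatial
    by (simp add: mkvec_0 inner_add_left inner_add_right W(2)[of "spatial x"] inner_commute[of _ b]
        algebra_simps)
  have skew': "transpose X ** Mmat + Mmat ** X = 0"
  proof (rule matrix_eq_if_inner_eq)
    fix x y
    have "x \<bullet> ((transpose X ** Mmat + Mmat ** X) *v y) = mink (X *v x) y + mink x (X *v y)"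
      by (simp add: mink_Mmat inner_vector_matrix matrix_vector_mul_assoc[symmetric]
          matrix_vector_mult_add_rdistrib inner_add_right)
    then show "x \<bullet> ((transpose X ** Mmat + Mmat ** X) *v y) = x \<bullet> (0 *v y)"
      by (simp add: skew)
  qed
  have Xw: "X *v wall_normal x = w (wall_normal x)" if x: "x \<in> set V96" for x
  proof (rule eqI)
    have wn: "spatial (wall_normal x) = qval x" "wall_normal x $ 0 = s"
      by (simp_all add: wall_normal_def mkvec_0 s_def)
    show "spatial (X *v wall_normal x) = spatial (w (wall_normal x))"
      using s u[OF x] by (simp add: X f_def wn u_def)
    \<comment> \<open>Skewness removes \<open>W\<close> from the time component, leaving b . x / s
      as in \<open>f\<close>.\<close>
    have "W (qval x) \<bullet> qval x = 0" using W(2)[of "qval x" "qval x"] by (simp add: inner_commute)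
    then have "w (wall_normal x) $ 0 * s = b \<bullet> qval x"
      using time[OF x] u[OF x] by (simp add: inner_add_left)
    then show "(X *v wall_normal x) $ 0 = w (wall_normal x) $ 0"
      using s by (simp add: X f_def wn mkvec_0 field_simps)
  qed
  have "v n = X ** refl_mat n - refl_mat n ** X" if n: "n \<in> normals96" for n
  proof (rule skew_deformation_is_commutator[OF mink_pos_if_normals96[OF n] skew])
    obtain x where x: "x \<in> set V96" "n = wall_normal x" using n unfolding normals96_eq by blast
    then show "v n *v y = (- 2 / mink n n) *\<^sub>R (mink y (X *v n) *\<^sub>R n + mink y n *\<^sub>R (X *v n))" for y
      using v[OF n] Xw x by simp
  qed
  then show "inf_conjugation refl_mat v" using skew' by (rule inf_conjugation_commutator[rotated])
qed

end
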